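(* Let $G=(V,E)$ be a connected undirected graph that is not a tree, with $n=|V|$ and $m=|E|$. Then the expected number of random variables drawn by the sink-popping algorithm on $G$ (including the initial draws) to sample a sink-free orientation is at most $m+n(n-1)$.
   Context: Sink-popping: orient each edge independently and uniformly at random (one random variable per edge); while some vertex is a sink (has no outgoing edge), re-orient independently and uniformly at random every edge incident to some sink; output the final orientation, which is a uniformly random sink-free orientation of $G$. *)

theory Defs
  imports "HOL-Probability.Probability"
begin

definition simple_graph :: "'a set \<Rightarrow> 'a set set \<Rightarrow> bool" where
  "simple_graph V E \<longleftrightarrow> finite V \<and> (\<forall>e\<in>E. e \<subseteq> V \<and> card e = 2)"

definition connected_graph :: "'a set \<Rightarrow> 'a set set \<Rightarrow> bool" where
  "connected_graph V E \<longleftrightarrow>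
     V \<noteq> {} \<and> (\<forall>u\<in>V. \<forall>v\<in>V. (u, v) \<in> {(x, y). {x, y} \<in> E}\<^sup>*)"

definition is_cycle :: "'a set set \<Rightarrow> 'a list \<Rightarrow> bool" where
  "is_cycle E vs \<longleftrightarrow> length vs \<ge> 3 \<and> distinct vs \<and>
     (\<forall>i<length vs. {vs ! i, vs ! ((i + 1) mod length vs)} \<in> E)"

definition is_tree :: "'a set \<Rightarrow> 'a set set \<Rightarrow> bool" where
  "is_tree V E \<longleftrightarrow> connected_graph V E \<and> (\<nexists>vs. is_cycle E vs)"

text \<open>
  An orientation is a map sending each edge to its head, one of its two endpoints.
  Its values outside the edge set are irrelevant.
\<close>

type_synonym 'a orientation = "'a set \<Rightarrow> 'a"

definition is_sink :: "'a set \<Rightarrow> 'a set set \<Rightarrow> 'a orientation \<Rightarrow> 'a \<Rightarrow> bool" where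
  "is_sink V E \<sigma> v \<longleftrightarrow> v \<in> V \<and> \<not> (\<exists>e\<in>E. v \<in> e \<and> \<sigma> e \<noteq> v)"

definition sink_edges :: "'a set \<Rightarrow> 'a set set \<Rightarrow> 'a orientation \<Rightarrow> 'a set set" where
  "sink_edges V E \<sigma> = {e \<in> E. \<exists>v\<in>e. is_sink V E \<sigma> v}"

definition random_orientation :: "'a set set \<Rightarrow> 'a orientation pmf" where
  "random_orientation F = Pi_pmf F undefined (\<lambda>e. pmf_of_set e)"

text \<open>
  The loop carries the number \<open>k\<close> of random variables drawn so far. It is a least fixed
  point, so the mass that the resulting subprobability distribution puts on \<open>None\<close> is
  the probability that the loop does not terminate.
\<close>

partial_function (spmf) pop_sinks ::
  "'a set \<Rightarrow> 'a set set \<Rightarrow> 'a orientation \<Rightarrow> nat \<Rightarrow> ('a orientation \<times> nat) spmf" where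
  "pop_sinks V E \<sigma> k =
     (if \<exists>v. is_sink V E \<sigma> v
      then bind_spmf (spmf_of_pmf (random_orientation (sink_edges V E \<sigma>)))
             (\<lambda>\<tau>. pop_sinks V E (override_on \<sigma> \<tau> (sink_edges V E \<sigma>))
                    (k + card (sink_edges V E \<sigma>)))
      else return_spmf (\<sigma>, k))"

definition sink_popping :: "'a set \<Rightarrow> 'a set set \<Rightarrow> ('a orientation \<times> nat) spmf" where
  "sink_popping V E =
     bind_spmf (spmf_of_pmf (random_orientation E)) (\<lambda>\<sigma>. pop_sinks V E \<sigma> (card E))"

text \<open>
  A run that never terminates counts as infinitely many draws. This is the actual number
  whenever no vertex is isolated, since every round then redraws at least one edge.
\<close>

definition expected_draws :: "'a set \<Rightarrow> 'a set set \<Rightarrow> ennreal" where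
  "expected_draws V E =
     (\<integral>\<^sup>+ r. (case r of None \<Rightarrow> \<infinity> | Some (\<sigma>, k) \<Rightarrow> of_nat k) \<partial>measure_pmf (sink_popping V E))"

end

theory Submission
  imports Defs
begin

text \<open>
  Write \<open>N S\<close> for the number of orientations whose set of sinks is \<open>S\<close>, \<open>d v\<close> for the degree of
  \<open>v\<close>, and let \<open>K = (\<Sum>v. d v * N {v}) / N {}\<close>.

  Redrawing the edges at an independent set \<open>S\<close> of sinks turns the uniform distribution on the
  orientations with sink set \<open>S\<close> into the uniform distribution on those without sinks at distance at
  least two from \<open>S\<close>. By induction on the number of rounds, the expected number of redraws from a
  start without sinks in \<open>A\<close> is therefore at most that predicted by the linear functional
  \<open>draws_avoiding A\<close>, which satisfies the same recursion. The base case is its nonnegativity, a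
  correlation inequality of Shearer type. For empty \<open>A\<close> this bounds the expected number of
  redraws by \<open>K\<close>; as every round redraws at least one edge, the loop terminates almost surely.

  It remains to see \<open>K \<le> n (n - 1)\<close>. If all degrees are at least two, fix a rotor at each vertex:
  a fixed-point-free permutation of its edges. Given an orientation with the unique sink \<open>v\<close> and an
  edge at \<open>v\<close>, flip that edge; if its other end becomes a sink, flip the next edge in rotor order
  there, and so on. The walk never revisits a vertex, so it ends in a sink-free orientation, and
  it can be reconstructed from that orientation, its last sink and its first vertex, which differs
  from the final vertex. Leaves are removed by induction.
\<close>

subsection \<open>Resampling at an independent set\<close>

text \<open>Extensionality gives every orientation of \<open>F\<close> exactly one representative,
  so cardinalities count orientations. The default value outside \<open>F\<close> is the one that
  \<open>random_orientation\<close> uses.\<close>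

definition orientations :: "'a set set \<Rightarrow> 'a orientation set" where
  "orientations F = Pi\<^sub>E F (\<lambda>e. e)"

definition sinks :: "'a set \<Rightarrow> 'a set set \<Rightarrow> 'a orientation \<Rightarrow> 'a set" where
  "sinks V E \<sigma> = {v. is_sink V E \<sigma> v}"

definition incident :: "'a set set \<Rightarrow> 'a set \<Rightarrow> 'a set set" where
  "incident E S = {e \<in> E. e \<inter> S \<noteq> {}}"

text \<open>A predicate on the whole sink set covers both kinds of event needed: a prescribed sink
  set, and no sink inside a given set.\<close>

definition sink_count :: "'a set \<Rightarrow> 'a set set \<Rightarrow> ('a set \<Rightarrow> bool) \<Rightarrow> nat" where
  "sink_count V E P = card {\<sigma> \<in> orientations E. P (sinks V E \<sigma>)}"

section \<open>Orientations, sinks, and the edges redrawn at a set of sinks\<close>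

locale graph =
  fixes V :: "'a set" and E :: "'a set set"
  assumes simple: "simple_graph V E"
begin

lemma finite_V: "finite V"
  using simple by (simp add: simple_graph_def)

lemma edge_subset: "e \<in> E \<Longrightarrow> e \<subseteq> V"
  using simple by (simp add: simple_graph_def)

lemma card_edge: "e \<in> E \<Longrightarrow> card e = 2"
  using simple by (simp add: simple_graph_def)

lemma finite_E: "finite E"
  using finite_subset[of E "Pow V"] edge_subset finite_V by blast

lemma finite_edge: "e \<in> E \<Longrightarrow> finite e"
  by (rule finite_subset[OF edge_subset finite_V])

lemma finite_orientations: "F \<subseteq> E \<Longrightarrow> finite (orientations F)"
  unfolding orientations_def
  using finite_subset[OF _ finite_E] finite_edge by (intro finite_PiE) blast+

lemma card_orientations:
  assumes "F \<subseteq> E" shows "card (orientations F) = 2 ^ card F"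
proof -
  have "finite F" using assms finite_E finite_subset by blast
  then have "card (orientations F) = (\<Prod>e\<in>F. card e)"
    unfolding orientations_def by (rule card_PiE)
  also have "\<dots> = (\<Prod>e\<in>F. 2)"
    using assms card_edge by (intro prod.cong) auto
  finally show ?thesis by simp
qed

lemma orientations_nonempty: "F \<subseteq> E \<Longrightarrow> orientations F \<noteq> {}"
  using card_orientations[of F] by fastforce

lemma head_in: "\<sigma> \<in> orientations F \<Longrightarrow> e \<in> F \<Longrightarrow> \<sigma> e \<in> e"
  by (auto simp: orientations_def)

lemma random_orientation_eq:
  assumes "F \<subseteq> E" shows "random_orientation F = pmf_of_set (orientations F)"
proof -
  have "random_orientation F = pmf_of_set (PiE_dflt F undefined (\<lambda>e. e))"
    unfolding random_orientation_def
  proof (rule Pi_pmf_of_set)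
    show "finite F" using assms finite_E finite_subset by blast
    show "finite e" "e \<noteq> {}" if "e \<in> F" for e
      using that assms finite_edge card_edge[of e] by auto
  qed
  also have "PiE_dflt F undefined (\<lambda>e. e) = orientations F"
    by (auto simp: PiE_dflt_def orientations_def PiE_def extensional_def)
  finally show ?thesis .
qed

lemma sinks_subset: "sinks V E \<sigma> \<subseteq> V"
  by (auto simp: sinks_def is_sink_def)

lemma mem_sinks: "v \<in> sinks V E \<sigma> \<longleftrightarrow> v \<in> V \<and> (\<forall>e\<in>E. v \<in> e \<longrightarrow> \<sigma> e = v)"
  by (auto simp: sinks_def is_sink_def)

lemma sink_edges_eq: "sink_edges V E \<sigma> = incident E (sinks V E \<sigma>)"
  by (auto simp: sink_edges_def incident_def sinks_def)

lemma incident_subset: "incident E S \<subseteq> E"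
  by (auto simp: incident_def)

lemma finite_incident: "finite (incident E S)"
  by (rule finite_subset[OF incident_subset finite_E])

definition independent :: "'a set \<Rightarrow> bool" where
  "independent S \<longleftrightarrow> S \<subseteq> V \<and> (\<forall>e\<in>E. \<forall>u\<in>e \<inter> S. \<forall>v\<in>e \<inter> S. u = v)"

text \<open>An edge joining two sinks would need two heads.\<close>

lemma independent_sinks: "independent (sinks V E \<sigma>)"
  unfolding independent_def by (metis IntE mem_sinks sinks_subset)

lemma independent_subset: "independent S \<Longrightarrow> T \<subseteq> S \<Longrightarrow> independent T"
  unfolding independent_def by (meson Int_iff subset_iff)

text \<open>The vertices at distance at least two from \<open>S\<close>. Removing \<open>S\<close>
  itself matters for isolated vertices, which lie on no edge.\<close>

definition far :: "'a set \<Rightarrow> 'a set" where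
  "far S = V - S - \<Union> (incident E S)"

lemma far_subset: "far S \<subseteq> V" by (auto simp: far_def)

text \<open>\<open>THE\<close> is well-defined here only for independent \<open>S\<close>.\<close>

definition inwards :: "'a set \<Rightarrow> 'a orientation \<Rightarrow> 'a orientation" where
  "inwards S \<sigma> = (\<lambda>e. if e \<in> incident E S then THE v. v \<in> e \<inter> S else \<sigma> e)"

lemma inwards_incident:
  assumes "independent S" "e \<in> E" "v \<in> e" "v \<in> S"
  shows "inwards S \<sigma> e = v"
proof -
  have "(THE u. u \<in> e \<inter> S) = v"
    using assms unfolding independent_def by (intro the_equality) auto
  then show ?thesis using assms by (auto simp: inwards_def incident_def)
qed

lemma inwards_in_orientations:
  assumes "independent S" "\<sigma> \<in> orientations E"
  shows "inwards S \<sigma> \<in> orientations E"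
proof -
  have "inwards S \<sigma> e \<in> e" if "e \<in> E" for e
  proof (cases "e \<in> incident E S")
    case True
    then obtain v where "v \<in> e" "v \<in> S" by (auto simp: incident_def)
    then show ?thesis using inwards_incident[OF assms(1) that] by simp
  next
    case False
    then show ?thesis using head_in[OF assms(2) that] by (simp add: inwards_def)
  qed
  moreover have "inwards S \<sigma> e = undefined" if "e \<notin> E" for e
    using that assms(2) by (auto simp: orientations_def PiE_def extensional_def inwards_def incident_def)
  ultimately show ?thesis by (simp add: orientations_def PiE_iff extensional_def)
qed

lemma sinks_inwards:
  assumes "independent S"
  shows "S \<subseteq> sinks V E (inwards S \<sigma>)"
proof
  fix v assume "v \<in> S"
  then show "v \<in> sinks V E (inwards S \<sigma>)"
    using assms inwards_incident[OF assms, of _ v] by (auto simp: independent_def mem_sinks)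
qed

text \<open>A far vertex lies on no redrawn edge, so the redraw cannot change whether it is a
  sink.\<close>

lemma sinks_override_far:
  "sinks V E (override_on \<sigma> \<tau> (incident E S)) \<inter> far S = sinks V E \<sigma> \<inter> far S"
proof -
  have "v \<in> sinks V E (override_on \<sigma> \<tau> (incident E S)) \<longleftrightarrow> v \<in> sinks V E \<sigma>" if "v \<in> far S" for v
  proof -
    have "e \<notin> incident E S" if "v \<in> e" for e using that \<open>v \<in> far S\<close> by (auto simp: far_def)
    then show ?thesis by (simp add: mem_sinks)
  qed
  then show ?thesis by auto
qed

lemma sinks_diff_eq:
  assumes "S \<subseteq> sinks V E \<sigma>"
  shows "sinks V E \<sigma> - S = sinks V E \<sigma> \<inter> far S"
proof -
  have "v \<notin> \<Union> (incident E S)" if v: "v \<in> sinks V E \<sigma>" "v \<notin> S" for v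
  proof
    assume "v \<in> \<Union> (incident E S)"
    then obtain e u where "e \<in> E" "v \<in> e" "u \<in> e" "u \<in> S" by (auto simp: incident_def)
    then have "u = v" using assms v(1) by (metis mem_sinks subsetD)
    then show False using v \<open>u \<in> S\<close> by simp
  qed
  then show ?thesis using sinks_subset by (auto simp: far_def)
qed

text \<open>Redrawing at \<open>S\<close> is reversible: the old orientation is recovered by
  pointing every edge at \<open>S\<close> into \<open>S\<close>, and the redraw by restricting the
  result to these edges. Sinks far from \<open>S\<close> survive in both directions, so
  \<open>P\<close> carries over. This is the exact form of the claim that a round preserves
  uniformity.\<close>

lemma sum_resample:
  fixes g :: "'a orientation \<Rightarrow> real"
  assumes S: "independent S"
  shows "(\<Sum>\<sigma> | \<sigma> \<in> orientations E \<and> S \<subseteq> sinks V E \<sigma> \<and> P (sinks V E \<sigma> - S).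
            \<Sum>\<tau>\<in>orientations (incident E S). g (override_on \<sigma> \<tau> (incident E S)))
       = (\<Sum>\<sigma> | \<sigma> \<in> orientations E \<and> P (sinks V E \<sigma> \<inter> far S). g \<sigma>)"
    (is "(\<Sum>\<sigma>\<in>?A. _) = sum g ?B")
proof -
  let ?I = "incident E S"
  let ?C = "?A \<times> orientations ?I"
  let ?f = "\<lambda>(\<sigma>, \<tau>). override_on \<sigma> \<tau> ?I"
  let ?h = "\<lambda>\<sigma>. (inwards S \<sigma>, restrict \<sigma> ?I)"
  have "sum g ?B = (\<Sum>p\<in>?C. g (?f p))"
  proof (rule sum.reindex_bij_witness[of _ ?f ?h])
    fix \<sigma> assume \<sigma>: "\<sigma> \<in> ?B"
    show *: "?f (?h \<sigma>) = \<sigma>" by (auto simp: override_on_def inwards_def)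
    have "sinks V E (inwards S \<sigma>) - S = sinks V E (inwards S \<sigma>) \<inter> far S"
      using S by (intro sinks_diff_eq sinks_inwards)
    \<comment> \<open>Turning edges inwards is itself an override on the edges at \<open>S\<close>,
      hence keeps the far sinks.\<close>
    moreover have "override_on \<sigma> (inwards S \<sigma>) ?I = inwards S \<sigma>"
      by (auto simp: override_on_def inwards_def)
    ultimately have "sinks V E (inwards S \<sigma>) - S = sinks V E \<sigma> \<inter> far S"
      using sinks_override_far[of \<sigma> "inwards S \<sigma>" S] by simp
    moreover have "restrict \<sigma> ?I \<in> orientations ?I"
      using \<sigma> head_in incident_subset by (fastforce simp: orientations_def)
    ultimately show "?h \<sigma> \<in> ?C"
      using \<sigma> S sinks_inwards inwards_in_orientations by auto
    show "g (?f (?h \<sigma>)) = g \<sigma>" by (simp only: *)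
  next
    fix p assume p: "p \<in> ?C"
    obtain \<sigma> \<tau> where [simp]: "p = (\<sigma>, \<tau>)" by force
    have \<sigma>: "\<sigma> \<in> orientations E" "S \<subseteq> sinks V E \<sigma>" "P (sinks V E \<sigma> - S)"
      and \<tau>: "\<tau> \<in> orientations ?I" using p by auto
    have "inwards S (override_on \<sigma> \<tau> ?I) e = \<sigma> e" for e
    proof (cases "e \<in> ?I")
      case True
      then obtain v where v: "v \<in> e" "v \<in> S" "e \<in> E" by (auto simp: incident_def)
      then have "\<sigma> e = v" using \<sigma>(2) by (auto simp: mem_sinks)
      then show ?thesis using v inwards_incident[OF S] by simp
    qed (simp add: inwards_def)
    moreover have "restrict (override_on \<sigma> \<tau> ?I) ?I = \<tau>"
      using \<tau> by (auto simp: orientations_def PiE_def extensional_def restrict_def override_on_def)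
    ultimately show "?h (?f p) = p" by auto
    have "override_on \<sigma> \<tau> ?I \<in> orientations E"
      using \<sigma>(1) \<tau> incident_subset[of S]
      by (auto simp: orientations_def PiE_def extensional_def Pi_def override_on_def)
    then show "?f p \<in> ?B"
      using \<sigma> sinks_diff_eq sinks_override_far by auto
  qed
  also have "\<dots> = (\<Sum>\<sigma>\<in>?A. \<Sum>\<tau>\<in>orientations ?I. g (override_on \<sigma> \<tau> ?I))"
    by (simp add: sum.cartesian_product case_prod_unfold)
  finally show ?thesis by simp
qed

lemma sink_count_resample:
  assumes "independent S"
  shows "2 ^ card (incident E S) * sink_count V E (\<lambda>X. S \<subseteq> X \<and> P (X - S))
       = sink_count V E (\<lambda>X. P (X \<inter> far S))"
proof -
  have "real (2 ^ card (incident E S) * sink_count V E (\<lambda>X. S \<subseteq> X \<and> P (X - S)))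
       = real (sink_count V E (\<lambda>X. P (X \<inter> far S)))"
    using sum_resample[OF assms, of "\<lambda>_. 1" P]
    by (simp add: sink_count_def card_orientations incident_subset mult.commute)
  then show ?thesis by linarith
qed

end

subsection \<open>Correlation of avoided sets\<close>

context graph
begin

abbreviation count :: "('a set \<Rightarrow> bool) \<Rightarrow> real" where
  "count P \<equiv> real (sink_count V E P)"

lemma sink_count_cong:
  assumes "\<And>X. independent X \<Longrightarrow> P X \<longleftrightarrow> Q X"
  shows "sink_count V E P = sink_count V E Q"
  unfolding sink_count_def using assms[OF independent_sinks] by simp

lemma sink_count_mono:
  assumes "\<And>X. independent X \<Longrightarrow> P X \<Longrightarrow> Q X"
  shows "sink_count V E P \<le> sink_count V E Q"
  unfolding sink_count_def
  by (rule card_mono) (use assms[OF independent_sinks] finite_orientations[OF order_refl] in auto)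

lemma sink_count_eq_0:
  assumes "\<And>X. independent X \<Longrightarrow> \<not> P X"
  shows "sink_count V E P = 0"
  unfolding sink_count_def using assms[OF independent_sinks] by simp

lemma sink_count_add:
  assumes "\<And>X. independent X \<Longrightarrow> \<not> (P X \<and> Q X)"
  shows "sink_count V E P + sink_count V E Q = sink_count V E (\<lambda>X. P X \<or> Q X)"
proof -
  have "{\<sigma> \<in> orientations E. P (sinks V E \<sigma>) \<or> Q (sinks V E \<sigma>)} =
     {\<sigma> \<in> orientations E. P (sinks V E \<sigma>)} \<union> {\<sigma> \<in> orientations E. Q (sinks V E \<sigma>)}"
    by auto
  moreover have "{\<sigma> \<in> orientations E. P (sinks V E \<sigma>)} \<inter> {\<sigma> \<in> orientations E. Q (sinks V E \<sigma>)} = {}"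
    using assms[OF independent_sinks] by auto
  ultimately show ?thesis
    unfolding sink_count_def
    using finite_orientations[OF order_refl] by (simp add: card_Un_disjoint)
qed

lemma independentD: "independent X \<Longrightarrow> X \<subseteq> V"
  by (simp add: independent_def)

lemma independent_singleton: "v \<in> V \<Longrightarrow> independent {v}"
  by (simp add: independent_def)

text \<open>A deletion recurrence as for independence polynomials: from the orientations without
  sinks in \<open>A\<close>, remove those where \<open>w\<close> is a sink; resampling at
  \<open>w\<close> counts the latter.\<close>

lemma sink_count_insert:
  assumes "w \<in> V" "w \<notin> A"
  shows "count (\<lambda>X. X \<inter> insert w A = {}) = count (\<lambda>X. X \<inter> A = {})
     - count (\<lambda>X. X \<inter> (A \<inter> far {w}) = {}) / 2 ^ card (incident E {w})"
proof -
  have "2 ^ card (incident E {w}) * sink_count V E (\<lambda>X. {w} \<subseteq> X \<and> (X - {w}) \<inter> A = {})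
       = sink_count V E (\<lambda>X. (X \<inter> far {w}) \<inter> A = {})"
    using assms(1) by (intro sink_count_resample independent_singleton)
  moreover have "(\<lambda>X. (X \<inter> far {w}) \<inter> A = {}) = (\<lambda>X. X \<inter> (A \<inter> far {w}) = {})"
    by (intro ext) blast
  ultimately have "real (2 ^ card (incident E {w}) * sink_count V E (\<lambda>X. {w} \<subseteq> X \<and> (X - {w}) \<inter> A = {}))
       = count (\<lambda>X. X \<inter> (A \<inter> far {w}) = {})"
    by (simp only:)
  then have *: "count (\<lambda>X. X \<inter> (A \<inter> far {w}) = {}) / 2 ^ card (incident E {w})
      = count (\<lambda>X. {w} \<subseteq> X \<and> (X - {w}) \<inter> A = {})"
    by (simp add: field_simps)
  have "sink_count V E (\<lambda>X. X \<inter> insert w A = {}) + sink_count V E (\<lambda>X. {w} \<subseteq> X \<and> (X - {w}) \<inter> A = {})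
      = sink_count V E (\<lambda>X. X \<inter> insert w A = {} \<or> {w} \<subseteq> X \<and> (X - {w}) \<inter> A = {})"
    by (rule sink_count_add) blast
  also have "\<dots> = sink_count V E (\<lambda>X. X \<inter> A = {})"
    using assms(2) by (intro sink_count_cong) blast
  finally show ?thesis unfolding * by linarith
qed

end

section \<open>The Shearer-type correlation inequality\<close>

locale sink_free_graph = graph +
  assumes sink_free: "sink_count V E (\<lambda>X. X = {}) > 0"
begin

lemma count_avoid_pos: "count (\<lambda>X. X \<inter> A = {}) > 0"
proof -
  have "sink_count V E (\<lambda>X. X = {}) \<le> sink_count V E (\<lambda>X. X \<inter> A = {})"
    by (rule sink_count_mono) blast
  then show ?thesis using sink_free by linarith
qed

text \<open>For \<open>v\<close> in \<open>A\<close>: the more vertices are conditioned not to be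
  sinks, the less likely \<open>v\<close> is to avoid being one. The inequality is multiplicative,
  so \<open>B\<close> can be reached from \<open>A\<close> by adding one vertex at a time.\<close>

lemma avoid_correlation:
  "A \<subseteq> B \<Longrightarrow> B \<subseteq> V \<Longrightarrow>
    count (\<lambda>X. X \<inter> (A - {v}) = {}) * count (\<lambda>X. X \<inter> B = {})
    \<le> count (\<lambda>X. X \<inter> A = {}) * count (\<lambda>X. X \<inter> (B - {v}) = {})"
proof (induction "card B" arbitrary: A B rule: less_induct)
  case less
  let ?q = "\<lambda>A. count (\<lambda>X. X \<inter> A = {})"
  have pos: "?q A > 0" for A by (rule count_avoid_pos)
  show ?case
  proof (cases "A = B")
    case False
    then obtain w where w: "w \<in> B" "w \<notin> A" using less.prems by blast
    define B' where "B' = B - {w}"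
    have B: "B = insert w B'" "w \<notin> B'" "A \<subseteq> B'" "B' \<subseteq> V" "w \<in> V"
      using w less.prems by (auto simp: B'_def)
    have "finite B" using less.prems finite_V finite_subset by blast
    then have small: "card B' < card B" unfolding B'_def using w by (intro card_Diff1_less)
    have IH: "?q (A - {v}) * ?q B' \<le> ?q A * ?q (B' - {v})"
      by (rule less.hyps[OF small B(3,4)])
    \<comment> \<open>Adding the single vertex \<open>w\<close>. If \<open>w\<close> differs from
      \<open>v\<close>, the recurrence expands both sides; the leading products cancel, and the rest
      is the induction hypothesis for the part of \<open>B'\<close> far from
      \<open>w\<close>.\<close>
    have step: "?q (B' - {v}) * ?q B \<le> ?q B' * ?q (B - {v})"
    proof (cases "w = v")
      case True
      then have "B' - {v} = B'" "B - {v} = B'" using B by auto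
      moreover have "?q B \<le> ?q B'"
        unfolding B(1) of_nat_le_iff by (rule sink_count_mono) blast
      ultimately show ?thesis using pos[of B'] by (simp add: mult_left_mono)
    next
      case False
      let ?C = "B' \<inter> far {w}" and ?d = "2 ^ card (incident E {w}) :: real"
      have "?q (?C - {v}) * ?q B' \<le> ?q ?C * ?q (B' - {v})"
        by (rule less.hyps[OF small _ B(4)]) blast
      then have le: "?q (?C - {v}) / ?d * ?q B' \<le> ?q ?C / ?d * ?q (B' - {v})"
        by (simp add: divide_right_mono)
      have "B - {v} = insert w (B' - {v})" using B(1) False by auto
      then have 1: "?q (B - {v}) = ?q (B' - {v}) - ?q ((B' - {v}) \<inter> far {w}) / ?d"
        using sink_count_insert[of w "B' - {v}"] B by simp
      have 2: "?q B = ?q B' - ?q ?C / ?d"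
        using sink_count_insert[of w B'] B by simp
      have 3: "(B' - {v}) \<inter> far {w} = ?C - {v}" by blast
      show ?thesis unfolding 1 2 3 using le by (simp add: algebra_simps)
    qed
    \<comment> \<open>Chain the two inequalities and cancel the common positive factor.\<close>
    have "(?q (A - {v}) * ?q B') * (?q (B' - {v}) * ?q B) \<le> (?q A * ?q (B' - {v})) * (?q B' * ?q (B - {v}))"
      by (rule mult_mono[OF IH step]) simp_all
    then have "(?q B' * ?q (B' - {v})) * (?q (A - {v}) * ?q B) \<le> (?q B' * ?q (B' - {v})) * (?q A * ?q (B - {v}))"
      by (simp only: mult_ac)
    moreover have "?q B' * ?q (B' - {v}) > 0" using pos by simp
    ultimately show ?thesis by (simp only: mult_le_cancel_left_pos)
  qed (simp add: mult.commute)
qed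

text \<open>\<open>avoid_correlation\<close> with \<open>B = V\<close>: avoiding all of a set but
  \<open>v\<close> means avoiding the whole set or meeting it in \<open>v\<close> only, and after
  this split the pure product terms cancel.\<close>

lemma unique_sink_correlation:
  assumes "A \<subseteq> V" "v \<in> V"
  shows "count (\<lambda>X. X \<inter> A = {v}) * count (\<lambda>X. X = {}) \<le> count (\<lambda>X. X \<inter> A = {}) * count (\<lambda>X. X = {v})"
proof (cases "v \<in> A")
  case True
  have split: "count (\<lambda>X. X \<inter> (B - {v}) = {}) = count (\<lambda>X. X \<inter> B = {}) + count (\<lambda>X. X \<inter> B = {v})"
    if "v \<in> B" for B
  proof -
    have "sink_count V E (\<lambda>X. X \<inter> B = {}) + sink_count V E (\<lambda>X. X \<inter> B = {v})
        = sink_count V E (\<lambda>X. X \<inter> B = {} \<or> X \<inter> B = {v})"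
      by (rule sink_count_add) simp
    also have "\<dots> = sink_count V E (\<lambda>X. X \<inter> (B - {v}) = {})"
      by (rule sink_count_cong) (use that in blast)
    finally show ?thesis by linarith
  qed
  have V: "count (\<lambda>X. X \<inter> V = {}) = count (\<lambda>X. X = {})"
    "count (\<lambda>X. X \<inter> V = {v}) = count (\<lambda>X. X = {v})"
    unfolding of_nat_eq_iff by (rule sink_count_cong; use independentD in blast)+
  show ?thesis
    using avoid_correlation[OF assms(1) order_refl, of v]
    unfolding split[OF True] split[OF assms(2)] V by (simp add: algebra_simps)
next
  case False
  then have "sink_count V E (\<lambda>X. X \<inter> A = {v}) = 0"
    by (intro sink_count_eq_0) blast
  then show ?thesis by simp
qed

end

subsection \<open>Expected number of redraws in finitely many rounds\<close>

context graph
begin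

text \<open>The expectation of \<open>g\<close> after one round started at
  \<open>\<sigma>\<close>.\<close>

definition redraw_mean :: "('a orientation \<Rightarrow> real) \<Rightarrow> 'a orientation \<Rightarrow> real" where
  "redraw_mean g \<sigma> =
     (\<Sum>\<tau>\<in>orientations (sink_edges V E \<sigma>). g (override_on \<sigma> \<tau> (sink_edges V E \<sigma>)))
       / 2 ^ card (sink_edges V E \<sigma>)"

text \<open>The expected number of redraws in the first \<open>t\<close> rounds from
  \<open>\<sigma>\<close>; the initial draws are not included.\<close>

primrec draws :: "nat \<Rightarrow> 'a orientation \<Rightarrow> real" where
  "draws 0 \<sigma> = 0"
| "draws (Suc t) \<sigma> =
     (if sinks V E \<sigma> = {} then 0
      else card (sink_edges V E \<sigma>) + redraw_mean (draws t) \<sigma>)"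

lemma sum_count:
  assumes "finite \<S>"
  shows "(\<Sum>S\<in>\<S>. count (\<lambda>X. X = S)) = count (\<lambda>X. X \<in> \<S>)"
  using assms
proof (induction \<S> rule: finite_induct)
  case empty
  show ?case by (simp add: sink_count_def)
next
  case (insert S \<S>)
  have "sink_count V E (\<lambda>X. X = S) + sink_count V E (\<lambda>X. X \<in> \<S>) = sink_count V E (\<lambda>X. X = S \<or> X \<in> \<S>)"
    by (rule sink_count_add) (use insert.hyps in blast)
  then show ?case using insert by simp
qed

lemma sum_count_insert:
  assumes "finite \<S>" "\<And>S. S \<in> \<S> \<Longrightarrow> v \<notin> S"
  shows "(\<Sum>S\<in>\<S>. count (\<lambda>X. X = insert v S)) = count (\<lambda>X. v \<in> X \<and> X - {v} \<in> \<S>)"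
proof -
  have "inj_on (insert v) \<S>"
    using assms(2) by (auto intro!: inj_onI simp: insert_ident)
  then have "(\<Sum>S\<in>\<S>. count (\<lambda>X. X = insert v S)) = (\<Sum>S\<in>insert v ` \<S>. count (\<lambda>X. X = S))"
    by (simp add: sum.reindex)
  also have "\<dots> = count (\<lambda>X. X \<in> insert v ` \<S>)"
    using assms(1) by (intro sum_count) simp
  also have "\<dots> = count (\<lambda>X. v \<in> X \<and> X - {v} \<in> \<S>)"
    unfolding of_nat_eq_iff
  proof (rule sink_count_cong)
    fix X show "X \<in> insert v ` \<S> \<longleftrightarrow> v \<in> X \<and> X - {v} \<in> \<S>"
      using assms(2) by (auto simp: insert_absorb image_iff intro!: bexI[of _ "X - {v}"])
  qed
  finally show ?thesis .
qed

lemma card_incident: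
  assumes "independent S"
  shows "card (incident E S) = (\<Sum>v\<in>S. card (incident E {v}))"
proof -
  have "incident E S = (\<Union>v\<in>S. incident E {v})" by (auto simp: incident_def)
  moreover have "finite S" using assms finite_V finite_subset independentD by blast
  moreover have "incident E {u} \<inter> incident E {v} = {}" if "u \<in> S" "v \<in> S" "u \<noteq> v" for u v
    using assms that by (auto simp: incident_def independent_def)
  ultimately show ?thesis
    by (simp add: card_UN_disjoint finite_incident)
qed

end

section \<open>The linear functional that bounds the redraws\<close>

context sink_free_graph
begin

definition mean_draws :: real where
  "mean_draws = (\<Sum>v\<in>V. card (incident E {v}) * count (\<lambda>X. X = {v})) / count (\<lambda>X. X = {})"

text \<open>A total over the orientations without sinks in \<open>A\<close>, not an average. The
  constant \<open>mean_draws\<close> is the one for which the functional vanishes at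
  \<open>A = V\<close>, where the start is sink-free and nothing is redrawn.\<close>

definition draws_avoiding :: "'a set \<Rightarrow> real" where
  "draws_avoiding A = mean_draws * count (\<lambda>X. X \<inter> A = {})
     - (\<Sum>v\<in>V. card (incident E {v}) * count (\<lambda>X. X \<inter> A = {v}))"

lemma draws_avoiding_nonneg:
  assumes "A \<subseteq> V" shows "draws_avoiding A \<ge> 0"
proof -
  have "(\<Sum>v\<in>V. card (incident E {v}) * count (\<lambda>X. X \<inter> A = {v})) * count (\<lambda>X. X = {})
      = (\<Sum>v\<in>V. card (incident E {v}) * (count (\<lambda>X. X \<inter> A = {v}) * count (\<lambda>X. X = {})))"
    by (simp add: sum_distrib_right mult.assoc)
  also have "\<dots> \<le> (\<Sum>v\<in>V. card (incident E {v}) * (count (\<lambda>X. X \<inter> A = {}) * count (\<lambda>X. X = {v})))"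
    by (intro sum_mono mult_left_mono unique_sink_correlation assms) auto
  also have "\<dots> = count (\<lambda>X. X \<inter> A = {}) * (\<Sum>v\<in>V. card (incident E {v}) * count (\<lambda>X. X = {v}))"
    by (simp add: sum_distrib_left mult.left_commute)
  finally show ?thesis
    using sink_free unfolding draws_avoiding_def mean_draws_def by (simp add: field_simps)
qed

text \<open>Undoing the resampling at \<open>S\<close> turns counts relative to \<open>far S\<close>
  into counts of exact sink sets: no far sink means sink set \<open>S\<close>, and the single far
  sink \<open>v\<close> means sink set \<open>insert v S\<close>. A \<open>v\<close> in
  \<open>S\<close> is never far.\<close>

lemma draws_avoiding_far:
  assumes "independent S"
  shows "draws_avoiding (far S) / 2 ^ card (incident E S) =
     mean_draws * count (\<lambda>X. X = S)
       - (\<Sum>v\<in>V - S. card (incident E {v}) * count (\<lambda>X. X = insert v S))"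
proof -
  let ?c = "2 ^ card (incident E S) :: real"
  have scale: "?c * count (\<lambda>X. S \<subseteq> X \<and> P (X - S)) = count (\<lambda>X. P (X \<inter> far S))" for P
    using arg_cong[OF sink_count_resample[OF assms, of P], of real] by simp
  have "(\<lambda>X. S \<subseteq> X \<and> X - S = {}) = (\<lambda>X. X = S)" by auto
  then have q: "count (\<lambda>X. X \<inter> far S = {}) = ?c * count (\<lambda>X. X = S)"
    using scale[of "\<lambda>X. X = {}"] by simp
  have r: "count (\<lambda>X. X \<inter> far S = {v}) = ?c * count (\<lambda>X. X = insert v S)" if "v \<in> V - S" for v
  proof -
    have "(\<lambda>X. S \<subseteq> X \<and> X - S = {v}) = (\<lambda>X. X = insert v S)" using that by auto
    then show ?thesis using scale[of "\<lambda>X. X = {v}"] by simp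
  qed
  have "count (\<lambda>X. X \<inter> far S = {v}) = 0" if "v \<in> S" for v
    unfolding of_nat_eq_0_iff by (rule sink_count_eq_0) (use that in \<open>auto simp: far_def\<close>)
  then have "(\<Sum>v\<in>V. card (incident E {v}) * count (\<lambda>X. X \<inter> far S = {v}))
      = (\<Sum>v\<in>V - S. card (incident E {v}) * count (\<lambda>X. X \<inter> far S = {v}))"
    using finite_V by (intro sum.mono_neutral_right) auto
  also have "\<dots> = ?c * (\<Sum>v\<in>V - S. card (incident E {v}) * count (\<lambda>X. X = insert v S))"
    by (simp add: r sum_distrib_left mult_ac)
  finally show ?thesis unfolding draws_avoiding_def q by (simp add: field_simps)
qed

text \<open>Splitting by the sink set \<open>S\<close> of the start, each summand is the cost of the
  current round plus the value of the functional after it. Exchanging the sums over \<open>S\<close>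
  and \<open>v\<close> leaves, for each \<open>v\<close>, an identity between counts.\<close>

lemma draws_avoiding_recursion:
  assumes "A \<subseteq> V"
  shows "(\<Sum>S | S \<subseteq> V \<and> S \<inter> A = {} \<and> S \<noteq> {}.
            (\<Sum>v\<in>S. card (incident E {v})) * count (\<lambda>X. X = S) + mean_draws * count (\<lambda>X. X = S)
              - (\<Sum>v\<in>V - S. card (incident E {v}) * count (\<lambda>X. X = insert v S)))
       = draws_avoiding A"
proof -
  define \<S> where "\<S> = {S. S \<subseteq> V \<and> S \<inter> A = {} \<and> S \<noteq> {}}"
  let ?d = "\<lambda>v. real (card (incident E {v}))"
  have fin: "finite \<S>" unfolding \<S>_def using finite_V by simp
  have 1: "(\<Sum>S\<in>\<S>. (\<Sum>v\<in>S. card (incident E {v})) * count (\<lambda>X. X = S))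
      = (\<Sum>v\<in>V. ?d v * count (\<lambda>X. X \<in> \<S> \<and> v \<in> X))"
  proof -
    have "(\<Sum>S\<in>\<S>. (\<Sum>v\<in>S. card (incident E {v})) * count (\<lambda>X. X = S))
        = (\<Sum>S\<in>\<S>. \<Sum>v | v \<in> V \<and> v \<in> S. ?d v * count (\<lambda>X. X = S))"
      unfolding of_nat_sum sum_distrib_right
      by (intro sum.cong) (auto simp: \<S>_def)
    also have "\<dots> = (\<Sum>v\<in>V. \<Sum>S | S \<in> \<S> \<and> v \<in> S. ?d v * count (\<lambda>X. X = S))"
      by (rule sum.swap_restrict[OF fin finite_V])
    also have "\<dots> = (\<Sum>v\<in>V. ?d v * count (\<lambda>X. X \<in> \<S> \<and> v \<in> X))"
    proof (rule sum.cong[OF refl])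
      fix v
      have "finite {S \<in> \<S>. v \<in> S}" using fin by simp
      from sum_count[OF this]
      show "(\<Sum>S | S \<in> \<S> \<and> v \<in> S. ?d v * count (\<lambda>X. X = S)) = ?d v * count (\<lambda>X. X \<in> \<S> \<and> v \<in> X)"
        by (simp flip: sum_distrib_left)
    qed
    finally show ?thesis .
  qed
  have 2: "(\<Sum>S\<in>\<S>. \<Sum>v\<in>V - S. ?d v * count (\<lambda>X. X = insert v S))
      = (\<Sum>v\<in>V. ?d v * count (\<lambda>X. v \<in> X \<and> X - {v} \<in> \<S>))"
  proof -
    have "(\<Sum>S\<in>\<S>. \<Sum>v\<in>V - S. ?d v * count (\<lambda>X. X = insert v S))
        = (\<Sum>S\<in>\<S>. \<Sum>v | v \<in> V \<and> v \<notin> S. ?d v * count (\<lambda>X. X = insert v S))"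
      by (simp add: set_diff_eq)
    also have "\<dots> = (\<Sum>v\<in>V. \<Sum>S | S \<in> \<S> \<and> v \<notin> S. ?d v * count (\<lambda>X. X = insert v S))"
      by (rule sum.swap_restrict[OF fin finite_V])
    also have "\<dots> = (\<Sum>v\<in>V. ?d v * count (\<lambda>X. v \<in> X \<and> X - {v} \<in> \<S>))"
    proof (rule sum.cong[OF refl])
      fix v
      have "(\<Sum>S | S \<in> \<S> \<and> v \<notin> S. count (\<lambda>X. X = insert v S))
          = count (\<lambda>X. v \<in> X \<and> X - {v} \<in> {S \<in> \<S>. v \<notin> S})"
        using fin by (intro sum_count_insert) auto
      then show "(\<Sum>S | S \<in> \<S> \<and> v \<notin> S. ?d v * count (\<lambda>X. X = insert v S))
          = ?d v * count (\<lambda>X. v \<in> X \<and> X - {v} \<in> \<S>)"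
        by (simp flip: sum_distrib_left)
    qed
    finally show ?thesis .
  qed
  have 3: "(\<Sum>S\<in>\<S>. count (\<lambda>X. X = S)) = count (\<lambda>X. X \<inter> A = {}) - count (\<lambda>X. X = {})"
  proof -
    have "sink_count V E (\<lambda>X. X \<in> \<S>) + sink_count V E (\<lambda>X. X = {}) = sink_count V E (\<lambda>X. X \<in> \<S> \<or> X = {})"
      by (rule sink_count_add) (simp add: \<S>_def)
    also have "\<dots> = sink_count V E (\<lambda>X. X \<inter> A = {})"
      by (rule sink_count_cong) (auto simp: \<S>_def dest: independentD)
    finally show ?thesis unfolding sum_count[OF fin] by linarith
  qed
  \<comment> \<open>Both sides count the sink sets that contain \<open>v\<close> and avoid
    \<open>A\<close> elsewhere: once split by whether \<open>v\<close> lies in \<open>A\<close>,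
    once by whether \<open>v\<close> is the only sink.\<close>
  have 4: "count (\<lambda>X. X \<in> \<S> \<and> v \<in> X)
      = count (\<lambda>X. X = {v}) + count (\<lambda>X. v \<in> X \<and> X - {v} \<in> \<S>) - count (\<lambda>X. X \<inter> A = {v})"
    if "v \<in> V" for v
  proof -
    have "sink_count V E (\<lambda>X. X \<in> \<S> \<and> v \<in> X) + sink_count V E (\<lambda>X. X \<inter> A = {v})
        = sink_count V E (\<lambda>X. X \<in> \<S> \<and> v \<in> X \<or> X \<inter> A = {v})"
      by (rule sink_count_add) (auto simp: \<S>_def)
    also have "\<dots> = sink_count V E (\<lambda>X. X = {v} \<or> v \<in> X \<and> X - {v} \<in> \<S>)"
    proof (rule sink_count_cong)
      fix X assume "independent X"
      then have "X \<subseteq> V" by (rule independentD)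
      then show "(X \<in> \<S> \<and> v \<in> X \<or> X \<inter> A = {v}) \<longleftrightarrow> (X = {v} \<or> v \<in> X \<and> X - {v} \<in> \<S>)"
        unfolding \<S>_def mem_Collect_eq by blast
    qed
    also have "\<dots> = sink_count V E (\<lambda>X. X = {v}) + sink_count V E (\<lambda>X. v \<in> X \<and> X - {v} \<in> \<S>)"
      by (rule sink_count_add[symmetric]) (auto simp: \<S>_def)
    finally show ?thesis by linarith
  qed
  \<comment> \<open>The definition of \<open>mean_draws\<close> enters here: it makes the
    contributions of unique sinks cancel.\<close>
  have 5: "mean_draws * count (\<lambda>X. X = {}) = (\<Sum>v\<in>V. ?d v * count (\<lambda>X. X = {v}))"
    using sink_free by (simp add: mean_draws_def)
  have "(\<Sum>S\<in>\<S>. (\<Sum>v\<in>S. card (incident E {v})) * count (\<lambda>X. X = S) + mean_draws * count (\<lambda>X. X = S)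
              - (\<Sum>v\<in>V - S. ?d v * count (\<lambda>X. X = insert v S)))
      = (\<Sum>v\<in>V. ?d v * count (\<lambda>X. X \<in> \<S> \<and> v \<in> X)) + mean_draws * (\<Sum>S\<in>\<S>. count (\<lambda>X. X = S))
        - (\<Sum>v\<in>V. ?d v * count (\<lambda>X. v \<in> X \<and> X - {v} \<in> \<S>))"
    by (simp only: sum.distrib sum_subtractf 1 2 flip: sum_distrib_left)
  also have "(\<Sum>v\<in>V. ?d v * count (\<lambda>X. X \<in> \<S> \<and> v \<in> X))
      = (\<Sum>v\<in>V. ?d v * count (\<lambda>X. X = {v})) + (\<Sum>v\<in>V. ?d v * count (\<lambda>X. v \<in> X \<and> X - {v} \<in> \<S>))
        - (\<Sum>v\<in>V. ?d v * count (\<lambda>X. X \<inter> A = {v}))"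
    by (simp add: 4 algebra_simps sum.distrib sum_subtractf)
  also have "mean_draws * (\<Sum>S\<in>\<S>. count (\<lambda>X. X = S))
      = mean_draws * count (\<lambda>X. X \<inter> A = {}) - (\<Sum>v\<in>V. ?d v * count (\<lambda>X. X = {v}))"
    unfolding 3 by (simp add: right_diff_distrib 5)
  finally show ?thesis unfolding draws_avoiding_def \<S>_def by simp
qed

text \<open>One round from all starts with sink set \<open>S\<close> leads uniformly to the
  orientations without sinks in \<open>far S\<close>, so the induction must range over all
  \<open>A\<close> and is applied to \<open>far S\<close>.\<close>

lemma sum_draws_le:
  "A \<subseteq> V \<Longrightarrow> (\<Sum>\<sigma> | \<sigma> \<in> orientations E \<and> sinks V E \<sigma> \<inter> A = {}. draws t \<sigma>) \<le> draws_avoiding A"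
proof (induction t arbitrary: A)
  case 0
  then show ?case by (simp add: draws_avoiding_nonneg)
next
  case (Suc t)
  define \<S> where "\<S> = {S. S \<subseteq> V \<and> S \<inter> A = {} \<and> S \<noteq> {}}"
  let ?O = "\<lambda>S. {\<sigma> \<in> orientations E. sinks V E \<sigma> = S}"
  have "finite \<S>" unfolding \<S>_def using finite_V by simp
  have fin: "finite {\<sigma> \<in> orientations E. P \<sigma>}" for P
    using finite_orientations[OF order_refl] by simp
  have bound: "(\<Sum>\<sigma>\<in>?O S. draws (Suc t) \<sigma>)
      \<le> (\<Sum>v\<in>S. card (incident E {v})) * count (\<lambda>X. X = S) + mean_draws * count (\<lambda>X. X = S)
          - (\<Sum>v\<in>V - S. card (incident E {v}) * count (\<lambda>X. X = insert v S))"
    if "S \<in> \<S>" for S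
  proof (cases "independent S")
    case True
    let ?I = "incident E S"
    have eq: "?O S = {\<sigma> \<in> orientations E. S \<subseteq> sinks V E \<sigma> \<and> sinks V E \<sigma> - S = {}}" by auto
    have "(\<Sum>\<sigma>\<in>?O S. draws (Suc t) \<sigma>)
        = (\<Sum>\<sigma>\<in>?O S. card ?I + (\<Sum>\<tau>\<in>orientations ?I. draws t (override_on \<sigma> \<tau> ?I)) / 2 ^ card ?I)"
      using that by (intro sum.cong) (auto simp: redraw_mean_def sink_edges_eq \<S>_def)
    also have "\<dots> = card ?I * count (\<lambda>X. X = S)
        + (\<Sum>\<sigma>\<in>?O S. \<Sum>\<tau>\<in>orientations ?I. draws t (override_on \<sigma> \<tau> ?I)) / 2 ^ card ?I"
      by (simp add: sum.distrib sum_divide_distrib sink_count_def)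
    also have "(\<Sum>\<sigma>\<in>?O S. \<Sum>\<tau>\<in>orientations ?I. draws t (override_on \<sigma> \<tau> ?I))
        = (\<Sum>\<sigma> | \<sigma> \<in> orientations E \<and> sinks V E \<sigma> \<inter> far S = {}. draws t \<sigma>)"
      unfolding eq using sum_resample[OF True, of "draws t" "\<lambda>X. X = {}"] .
    also have "card ?I * count (\<lambda>X. X = S) + \<dots> / 2 ^ card ?I
        \<le> card ?I * count (\<lambda>X. X = S) + draws_avoiding (far S) / 2 ^ card ?I"
      using Suc.IH[OF far_subset, of S] by (simp add: divide_right_mono)
    also have "\<dots> = (\<Sum>v\<in>S. card (incident E {v})) * count (\<lambda>X. X = S) + mean_draws * count (\<lambda>X. X = S)
          - (\<Sum>v\<in>V - S. card (incident E {v}) * count (\<lambda>X. X = insert v S))"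
      unfolding draws_avoiding_far[OF True] by (simp add: card_incident[OF True])
    finally show ?thesis .
  next
    \<comment> \<open>Neither \<open>S\<close> nor any superset of it is then a sink set, so both
      sides vanish.\<close>
    case False
    then have "?O S = {}" using independent_sinks by auto
    moreover have "count (\<lambda>X. X = S) = 0"
      unfolding of_nat_eq_0_iff by (rule sink_count_eq_0) (use False in blast)
    moreover have "count (\<lambda>X. X = insert v S) = 0" for v
      unfolding of_nat_eq_0_iff
      by (rule sink_count_eq_0) (use False independent_subset subset_insertI in blast)
    ultimately show ?thesis by (simp only: sum.empty) simp
  qed
  \<comment> \<open>Sink-free starts cost nothing, so only nonempty sink sets remain.\<close>
  have "(\<Sum>\<sigma> | \<sigma> \<in> orientations E \<and> sinks V E \<sigma> \<inter> A = {}. draws (Suc t) \<sigma>)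
      = (\<Sum>\<sigma> | \<sigma> \<in> orientations E \<and> sinks V E \<sigma> \<in> \<S>. draws (Suc t) \<sigma>)"
  proof (rule sum.mono_neutral_right)
    show "\<forall>\<sigma>\<in>{\<sigma> \<in> orientations E. sinks V E \<sigma> \<inter> A = {}} - {\<sigma> \<in> orientations E. sinks V E \<sigma> \<in> \<S>}.
        draws (Suc t) \<sigma> = 0"
      using sinks_subset by (auto simp: \<S>_def)
  qed (use fin in \<open>auto simp: \<S>_def\<close>)
  also have "\<dots> = (\<Sum>S\<in>\<S>. \<Sum>\<sigma>\<in>{\<sigma> \<in> {\<sigma> \<in> orientations E. sinks V E \<sigma> \<in> \<S>}. sinks V E \<sigma> = S}. draws (Suc t) \<sigma>)"
    by (rule sum.group[symmetric]) (use fin \<open>finite \<S>\<close> in auto)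
  also have "\<dots> = (\<Sum>S\<in>\<S>. \<Sum>\<sigma>\<in>?O S. draws (Suc t) \<sigma>)"
    by (intro sum.cong) auto
  also have "\<dots> \<le> draws_avoiding A"
    unfolding draws_avoiding_recursion[OF Suc.prems, symmetric] \<S>_def[symmetric]
    by (rule sum_mono) (rule bound)
  finally show ?case .
qed

end

subsection \<open>Rotor walks\<close>

text \<open>Enumerate \<open>A\<close> and shift cyclically by one.\<close>

lemma ex_fixpoint_free_permutation:
  assumes "finite A" "card A \<ge> 2"
  shows "\<exists>\<rho>. inj_on \<rho> A \<and> (\<forall>a\<in>A. \<rho> a \<in> A \<and> \<rho> a \<noteq> a)"
proof -
  let ?n = "card A"
  obtain f where f: "bij_betw f {0..<?n} A"
    using ex_bij_betw_nat_finite[OF assms(1)] by blast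
  define g where "g = inv_into {0..<?n} f"
  have g: "bij_betw g A {0..<?n}" unfolding g_def using f by (rule bij_betw_inv_into)
  have fg: "f (g a) = a" if "a \<in> A" for a
    unfolding g_def using f that by (simp add: bij_betw_inv_into_right)
  have g_less: "g a < ?n" if "a \<in> A" for a using g that by (auto simp: bij_betw_def)
  define \<rho> where "\<rho> a = f (Suc (g a) mod ?n)" for a
  have cyc: "Suc i mod ?n \<noteq> i" "Suc i mod ?n < ?n" if "i < ?n" for i
    using that assms(2) by (auto simp: mod_Suc)
  have cyc_inj: "i = j" if "Suc i mod ?n = Suc j mod ?n" "i < ?n" "j < ?n" for i j
    using that by (auto simp: mod_Suc split: if_splits)
  have f_inj: "i = j" if "f i = f j" "i < ?n" "j < ?n" for i j
    using f that by (auto simp: bij_betw_def inj_on_def)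
  have "inj_on \<rho> A"
  proof (rule inj_onI)
    fix a b assume ab: "a \<in> A" "b \<in> A" "\<rho> a = \<rho> b"
    have "Suc (g a) mod ?n = Suc (g b) mod ?n"
      by (rule f_inj[OF ab(3)[unfolded \<rho>_def]]) (intro cyc(2) g_less ab)+
    then have "g a = g b" by (rule cyc_inj) (intro g_less ab)+
    then have "f (g a) = f (g b)" by (rule arg_cong)
    then show "a = b" unfolding fg[OF ab(1)] fg[OF ab(2)] .
  qed
  moreover have "\<rho> a \<in> A \<and> \<rho> a \<noteq> a" if a: "a \<in> A" for a
  proof
    have lt: "Suc (g a) mod ?n < ?n" using cyc(2) g_less[OF a] by blast
    then show "\<rho> a \<in> A" unfolding \<rho>_def using f by (auto simp: bij_betw_def)
    show "\<rho> a \<noteq> a"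
    proof
      assume "\<rho> a = a"
      then have "f (Suc (g a) mod ?n) = f (g a)" unfolding \<rho>_def fg[OF a] .
      then have "Suc (g a) mod ?n = g a" by (rule f_inj[OF _ lt g_less[OF a]])
      then show False using cyc(1)[OF g_less[OF a]] by simp
    qed
  qed
  ultimately show ?thesis by blast
qed

locale rotor_graph = graph V E for V :: "'a set" and E +
  fixes rotor :: "'a \<Rightarrow> 'a set \<Rightarrow> 'a set"
  assumes rotor_inj: "inj_on (rotor v) (incident E {v})"
    and rotor_incident: "e \<in> incident E {v} \<Longrightarrow> rotor v e \<in> incident E {v}"
    and rotor_neq: "e \<in> incident E {v} \<Longrightarrow> rotor v e \<noteq> e"
begin

definition darts :: "('a \<times> 'a set) set" where
  "darts = {(v, e). e \<in> E \<and> v \<in> e}"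

definition other :: "'a \<Rightarrow> 'a set \<Rightarrow> 'a" where
  "other v e = the_elem (e - {v})"

text \<open>A dart records the current vertex and the edge to be flipped next. The step never
  consults an orientation: the route depends on the dart alone, and the orientation only decides
  when the walk stops.\<close>

definition rotor_step :: "'a \<times> 'a set \<Rightarrow> 'a \<times> 'a set" where
  "rotor_step d = (other (fst d) (snd d), rotor (other (fst d) (snd d)) (snd d))"

definition vert :: "'a \<times> 'a set \<Rightarrow> nat \<Rightarrow> 'a" where
  "vert d i = fst ((rotor_step ^^ i) d)"

definition edge :: "'a \<times> 'a set \<Rightarrow> nat \<Rightarrow> 'a set" where
  "edge d i = snd ((rotor_step ^^ i) d)"

primrec walk :: "'a orientation \<Rightarrow> 'a \<times> 'a set \<Rightarrow> nat \<Rightarrow> 'a orientation" where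
  "walk \<sigma> d 0 = \<sigma>"
| "walk \<sigma> d (Suc i) = (walk \<sigma> d i)(edge d i := vert d (Suc i))"

definition walking :: "'a orientation \<Rightarrow> 'a \<times> 'a set \<Rightarrow> nat \<Rightarrow> bool" where
  "walking \<sigma> d k \<longleftrightarrow> (\<forall>i\<le>k. sinks V E (walk \<sigma> d i) = {vert d i})"

lemma edge_other:
  assumes "e \<in> E" "v \<in> e"
  shows "e = {v, other v e}" "other v e \<noteq> v"
proof -
  obtain x y where xy: "e = {x, y}" "x \<noteq> y"
    using card_edge[OF assms(1)] by (auto simp: card_2_iff)
  then have "e - {v} = {if v = x then y else x}" using assms(2) by auto
  then have "other v e = (if v = x then y else x)" by (simp add: other_def)
  then show "e = {v, other v e}" "other v e \<noteq> v" using xy assms(2) by auto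
qed

lemma other_other:
  assumes "e \<in> E" "v \<in> e" shows "other (other v e) e = v"
  using edge_other[OF assms] edge_other[OF assms(1), of "other v e"] by (metis insert_iff singletonD)

lemma rotor_step_darts: "d \<in> darts \<Longrightarrow> rotor_step d \<in> darts"
proof -
  assume "d \<in> darts"
  then obtain v e where d: "d = (v, e)" "e \<in> E" "v \<in> e" by (auto simp: darts_def)
  then have "e \<in> incident E {other v e}" using edge_other[OF d(2,3)] by (auto simp: incident_def)
  from rotor_incident[OF this] show ?thesis
    by (auto simp: rotor_step_def d darts_def incident_def)
qed

text \<open>The new vertex \<open>w\<close> and injectivity of its rotor give back the edge just
  crossed; its other end is the old vertex.\<close>

lemma inj_rotor_step: "inj_on rotor_step darts"
proof (rule inj_onI)
  fix d d' assume *: "d \<in> darts" "d' \<in> darts" "rotor_step d = rotor_step d'"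
  obtain v e v' e' where d: "d = (v, e)" "e \<in> E" "v \<in> e" "d' = (v', e')" "e' \<in> E" "v' \<in> e'"
    using *(1,2) by (auto simp: darts_def)
  have step_eq: "rotor_step (v, e) = rotor_step (v', e')" using *(3) unfolding d(1) d(4) .
  define w where "w = other v e"
  have w': "other v' e' = w" using step_eq by (simp add: rotor_step_def w_def)
  have "rotor (other v e) e = rotor (other v' e') e'"
    using step_eq unfolding rotor_step_def fst_conv snd_conv prod.inject by (rule conjunct2)
  then have r: "rotor w e = rotor w e'" unfolding w' w_def[symmetric] .
  have "e \<in> incident E {w}"
    using edge_other(1)[OF d(2,3)] d(2) unfolding incident_def w_def by blast
  moreover have "e' \<in> incident E {w}"
    using edge_other(1)[OF d(5,6)] d(5) unfolding incident_def w' by blast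
  ultimately have e: "e = e'" using inj_onD[OF rotor_inj r] by blast
  have "v = other w e" unfolding w_def by (rule other_other[OF d(2,3), symmetric])
  also have "\<dots> = v'" using other_other[OF d(5,6)] unfolding w' e .
  finally show "d = d'" using d(1,4) e by simp
qed

lemma funpow_darts: "d \<in> darts \<Longrightarrow> (rotor_step ^^ i) d \<in> darts"
  by (induction i) (auto intro: rotor_step_darts)

lemma inj_funpow_rotor_step: "inj_on (rotor_step ^^ i) darts"
proof (induction i)
  case (Suc i)
  show ?case
  proof (rule inj_onI)
    fix d d' assume *: "d \<in> darts" "d' \<in> darts" "(rotor_step ^^ Suc i) d = (rotor_step ^^ Suc i) d'"
    from *(3) have "rotor_step ((rotor_step ^^ i) d) = rotor_step ((rotor_step ^^ i) d')" by simp
    from inj_onD[OF inj_rotor_step this funpow_darts[OF *(1)] funpow_darts[OF *(2)]]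
    show "d = d'" using *(1,2) by (rule inj_onD[OF Suc.IH])
  qed
qed simp

lemma edge_in:
  assumes "d \<in> darts"
  shows "edge d i \<in> E" "vert d i \<in> edge d i" "vert d i \<in> V"
  using funpow_darts[OF assms, of i] edge_subset
  by (auto simp: darts_def edge_def vert_def split: prod.splits)

lemma vert_Suc:
  assumes "d \<in> darts"
  shows "edge d i = {vert d i, vert d (Suc i)}" "vert d (Suc i) \<noteq> vert d i"
  using edge_other[OF edge_in(1,2)[OF assms, of i]]
  by (simp_all add: vert_def edge_def rotor_step_def)

lemma edge_Suc:
  assumes "d \<in> darts"
  shows "edge d (Suc i) \<noteq> edge d i"
proof -
  have "edge d i \<in> incident E {vert d (Suc i)}"
    using edge_in(1)[OF assms] vert_Suc[OF assms] by (auto simp: incident_def)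
  from rotor_neq[OF this] show ?thesis
    by (simp add: vert_def edge_def rotor_step_def)
qed

lemma walk_orientation:
  assumes "d \<in> darts" "\<sigma> \<in> orientations E"
  shows "walk \<sigma> d i \<in> orientations E"
proof (induction i)
  case (Suc i)
  then show ?case
    using vert_Suc[OF assms(1), of i] edge_in(1)[OF assms(1), of i]
    by (auto simp: orientations_def PiE_def extensional_def)
qed (simp add: assms)

text \<open>Only one edge changes. It now leaves the old sink, so at most its new head can become a
  sink.\<close>

lemma sinks_walk_Suc:
  assumes d: "d \<in> darts" and s: "sinks V E (walk \<sigma> d i) = {vert d i}"
  shows "sinks V E (walk \<sigma> d (Suc i)) \<subseteq> {vert d (Suc i)}"
proof
  fix u assume u: "u \<in> sinks V E (walk \<sigma> d (Suc i))"
  show "u \<in> {vert d (Suc i)}"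
  proof (rule ccontr)
    assume neq: "u \<notin> {vert d (Suc i)}"
    have "u \<notin> edge d i" using u neq edge_in(1)[OF d, of i] unfolding mem_sinks by fastforce
    have "walk \<sigma> d i e = u" if "e \<in> E" "u \<in> e" for e
    proof -
      have "walk \<sigma> d (Suc i) e = u" using u that unfolding mem_sinks by blast
      moreover have "e \<noteq> edge d i" using that \<open>u \<notin> edge d i\<close> by blast
      ultimately show ?thesis by simp
    qed
    then have "u \<in> sinks V E (walk \<sigma> d i)"
      using u unfolding mem_sinks by blast
    then show False using s \<open>u \<notin> edge d i\<close> edge_in(2)[OF d, of i] by simp
  qed
qed

lemma walk_flip_out:
  assumes d: "d \<in> darts" and s: "sinks V E (walk \<sigma> d k) = {vert d k}"
    and e: "e \<in> E" "vert d k \<in> e"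
  shows "walk \<sigma> d (Suc k) e \<noteq> vert d k \<longleftrightarrow> e = edge d k"
proof -
  have "walk \<sigma> d k e = vert d k" using s e mem_sinks[of "vert d k"] by blast
  then show ?thesis using vert_Suc[OF d, of k] by simp
qed

text \<open>
  A walk could only close up by traversing the unique outgoing edge of an earlier vertex backwards,
  which would be the edge it has just used; the rotor has no fixed point, so it never does.
\<close>

lemma walking_fresh:
  assumes d: "d \<in> darts"
  shows "walking \<sigma> d k \<Longrightarrow>
    inj_on (vert d) {..Suc k} \<and>
    (\<forall>j\<le>k. \<forall>e\<in>E. vert d j \<in> e \<longrightarrow> (walk \<sigma> d (Suc k) e \<noteq> vert d j \<longleftrightarrow> e = edge d j))"
proof (induction k)
  case 0
  then have "sinks V E (walk \<sigma> d 0) = {vert d 0}" by (simp add: walking_def)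
  from walk_flip_out[OF d this] have "\<forall>j\<le>0. \<forall>e\<in>E. vert d j \<in> e \<longrightarrow>
      (walk \<sigma> d (Suc 0) e \<noteq> vert d j \<longleftrightarrow> e = edge d j)" by simp
  moreover have "{..Suc 0} = {0, Suc 0}" by auto
  ultimately show ?case using vert_Suc(2)[OF d, of 0] by simp
next
  case (Suc k)
  have inj: "inj_on (vert d) {..Suc k}"
    and out: "\<And>j e. j \<le> k \<Longrightarrow> e \<in> E \<Longrightarrow> vert d j \<in> e \<Longrightarrow>
      walk \<sigma> d (Suc k) e \<noteq> vert d j \<longleftrightarrow> e = edge d j"
    using Suc by (auto simp: walking_def)
  have s: "sinks V E (walk \<sigma> d (Suc k)) = {vert d (Suc k)}"
    using Suc.prems unfolding walking_def by blast
  then have at: "walk \<sigma> d (Suc k) (edge d (Suc k)) = vert d (Suc k)"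
    using edge_in[OF d, of "Suc k"] mem_sinks[of "vert d (Suc k)"] by blast
  have new: "vert d (Suc (Suc k)) \<noteq> vert d j" if "j \<le> Suc k" for j
  proof
    assume eq: "vert d (Suc (Suc k)) = vert d j"
    then have "j \<noteq> Suc k" using vert_Suc(2)[OF d, of "Suc k"] by auto
    then have j: "j \<le> k" using that by simp
    have "vert d j \<in> edge d (Suc k)" using vert_Suc(1)[OF d, of "Suc k"] eq by simp
    moreover have "walk \<sigma> d (Suc k) (edge d (Suc k)) \<noteq> vert d j"
      using at eq vert_Suc(2)[OF d, of "Suc k"] by simp
    ultimately have "edge d (Suc k) = edge d j"
      using out[OF j edge_in(1)[OF d, of "Suc k"]] by blast
    then have "{vert d (Suc k), vert d j} = {vert d j, vert d (Suc j)}"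
      using vert_Suc(1)[OF d, of "Suc k"] vert_Suc(1)[OF d, of j] eq by simp
    \<comment> \<open>The outgoing edge of an earlier vertex leads to its successor on the route, so
      freshness up to here leaves only \<open>j = k\<close>, an immediate reversal.\<close>
    then have "vert d (Suc k) = vert d (Suc j)"
      using eq vert_Suc(2)[OF d, of "Suc k"] by (auto simp: doubleton_eq_iff)
    then have "k = j" using j inj_onD[OF inj, of "Suc k" "Suc j"] by simp
    then show False using \<open>edge d (Suc k) = edge d j\<close> edge_Suc[OF d] by simp
  qed
  have "inj_on (vert d) {..Suc (Suc k)}"
    using inj new by (subst atMost_Suc) (auto simp: image_iff)
  moreover have "walk \<sigma> d (Suc (Suc k)) e \<noteq> vert d j \<longleftrightarrow> e = edge d j"
    if j: "j \<le> Suc k" and e: "e \<in> E" "vert d j \<in> e" for j e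
  proof (cases "j = Suc k")
    case True
    then show ?thesis using walk_flip_out[OF d s] e by simp
  next
    case False
    then have j': "j \<le> k" using j by simp
    have "vert d j \<noteq> vert d (Suc k)"
      using inj_onD[OF inj, of j "Suc k"] j' by auto
    moreover have "vert d j \<noteq> vert d (Suc (Suc k))" using new[OF j] by simp
    \<comment> \<open>Both ends of the newly flipped edge differ from \<open>vert d j\<close>, so
      the edges at earlier vertices stay as they were.\<close>
    ultimately have "e \<noteq> edge d (Suc k)" using vert_Suc(1)[OF d, of "Suc k"] e by auto
    then show ?thesis using out[OF j' e] by simp
  qed
  ultimately show ?case by blast
qed

text \<open>A walk that never ends would visit pairwise distinct vertices of the finite set
  \<open>V\<close> forever.\<close>

lemma walk_exits:
  assumes d: "d \<in> darts" and s: "sinks V E \<sigma> = {fst d}"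
  shows "\<exists>k. walking \<sigma> d k \<and> sinks V E (walk \<sigma> d (Suc k)) = {}"
proof (rule ccontr)
  assume contr: "\<not> ?thesis"
  have w: "walking \<sigma> d k" for k
  proof (induction k)
    case 0
    then show ?case using s by (simp add: walking_def vert_def)
  next
    case (Suc k)
    then have "sinks V E (walk \<sigma> d (Suc k)) \<noteq> {}" using contr by blast
    moreover have "sinks V E (walk \<sigma> d (Suc k)) \<subseteq> {vert d (Suc k)}"
      using Suc by (intro sinks_walk_Suc[OF d]) (simp add: walking_def)
    ultimately have "sinks V E (walk \<sigma> d (Suc k)) = {vert d (Suc k)}" by blast
    then show ?case using Suc by (simp add: walking_def le_Suc_eq)
  qed
  have "inj_on (vert d) {..Suc (card V)}" using walking_fresh[OF d w] by blast
  then have "card {..Suc (card V)} \<le> card V"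
    using finite_V edge_in(3)[OF d] by (intro card_inj_on_le[where f = "vert d"]) auto
  then show False by simp
qed

text \<open>At most one \<open>k\<close> qualifies, since a longer walk would need a sink where this
  one has none.\<close>

definition steps :: "'a orientation \<Rightarrow> 'a \<times> 'a set \<Rightarrow> nat" where
  "steps \<sigma> d = (SOME k. walking \<sigma> d k \<and> sinks V E (walk \<sigma> d (Suc k)) = {})"

definition outcome :: "'a orientation \<Rightarrow> 'a \<times> 'a set \<Rightarrow> 'a orientation" where
  "outcome \<sigma> d = walk \<sigma> d (Suc (steps \<sigma> d))"

lemma steps:
  assumes "d \<in> darts" "sinks V E \<sigma> = {fst d}"
  shows "walking \<sigma> d (steps \<sigma> d)" "sinks V E (outcome \<sigma> d) = {}"
  using someI_ex[OF walk_exits[OF assms]] by (simp_all add: steps_def outcome_def)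

text \<open>For a fixed dart the flips can be undone from the last to the first: before each flip
  its edge pointed to the vertex that was the sink.\<close>

lemma walk_inj:
  assumes d: "d \<in> darts"
    and "\<And>i. i < n \<Longrightarrow> sinks V E (walk \<sigma> d i) = {vert d i}"
    and "\<And>i. i < n \<Longrightarrow> sinks V E (walk \<sigma>' d i) = {vert d i}"
    and "walk \<sigma> d n = walk \<sigma>' d n"
  shows "\<sigma> = \<sigma>'"
  using assms(2-)
proof (induction n)
  case (Suc n)
  have at: "walk \<sigma>'' d n (edge d n) = vert d n" if "sinks V E (walk \<sigma>'' d n) = {vert d n}" for \<sigma>''
    using that edge_in[OF d, of n] mem_sinks[of "vert d n"] by blast
  have "walk \<sigma> d n e = walk \<sigma>' d n e" for e
  proof (cases "e = edge d n")
    case True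
    then show ?thesis using at[of \<sigma>] at[of \<sigma>'] Suc.prems by simp
  next
    case False
    then show ?thesis using fun_cong[OF Suc.prems(3), of e] by simp
  qed
  then show ?case using Suc.prems by (intro Suc.IH) auto
qed simp

lemma outcome_inj:
  assumes "d \<in> darts" "sinks V E \<sigma> = {fst d}" "sinks V E \<sigma>' = {fst d}"
    and "steps \<sigma> d = steps \<sigma>' d" "outcome \<sigma> d = outcome \<sigma>' d"
  shows "\<sigma> = \<sigma>'"
proof (rule walk_inj[OF assms(1)])
  show "sinks V E (walk \<sigma> d i) = {vert d i}" "sinks V E (walk \<sigma>' d i) = {vert d i}"
    if "i < Suc (steps \<sigma> d)" for i
    using that steps(1)[OF assms(1,2)] steps(1)[OF assms(1,3)] assms(4)
    unfolding walking_def less_Suc_eq_le by metis+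
  show "walk \<sigma> d (Suc (steps \<sigma> d)) = walk \<sigma>' d (Suc (steps \<sigma> d))"
    using assms(5) unfolding outcome_def assms(4) .
qed

text \<open>For a fixed dart, \<open>\<sigma>\<close> is determined by the outcome and the vertex
  reached last. As the route does not revisit vertices, that vertex fixes the number of steps, and
  it differs from the starting vertex.\<close>

lemma sink_count_singleton_le:
  assumes "d \<in> darts"
  shows "sink_count V E (\<lambda>X. X = {fst d}) \<le> (card V - 1) * sink_count V E (\<lambda>X. X = {})"
proof -
  let ?A = "{\<sigma> \<in> orientations E. sinks V E \<sigma> = {fst d}}"
  let ?B = "{\<sigma> \<in> orientations E. sinks V E \<sigma> = {}}"
  let ?f = "\<lambda>\<sigma>. (outcome \<sigma> d, vert d (Suc (steps \<sigma> d)))"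
  have inj: "inj_on (vert d) {..Suc (steps \<sigma> d)}" if "sinks V E \<sigma> = {fst d}" for \<sigma>
    using walking_fresh[OF assms steps(1)[OF assms that]] by blast
  have "inj_on ?f ?A"
  proof (rule inj_onI)
    fix \<sigma> \<sigma>' assume *: "\<sigma> \<in> ?A" "\<sigma>' \<in> ?A" "?f \<sigma> = ?f \<sigma>'"
    \<comment> \<open>Both walks follow the same route, so freshness along the longer one compares
      their end points.\<close>
    let ?m = "Suc (max (steps \<sigma> d) (steps \<sigma>' d))"
    have "inj_on (vert d) {..?m}"
      using inj[of \<sigma>] inj[of \<sigma>'] * by (simp add: max_def)
    from inj_onD[OF this, of "Suc (steps \<sigma> d)" "Suc (steps \<sigma>' d)"]
    have "steps \<sigma> d = steps \<sigma>' d" using * by simp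
    from outcome_inj[OF assms _ _ this] show "\<sigma> = \<sigma>'" using * by simp
  qed
  moreover have "?f ` ?A \<subseteq> ?B \<times> (V - {fst d})"
  proof safe
    fix \<sigma> assume \<sigma>: "\<sigma> \<in> orientations E" "sinks V E \<sigma> = {fst d}"
    show "outcome \<sigma> d \<in> orientations E"
      unfolding outcome_def by (rule walk_orientation[OF assms \<sigma>(1)])
    show "x \<in> {}" if "x \<in> sinks V E (outcome \<sigma> d)" for x
      using that steps(2)[OF assms \<sigma>(2)] by simp
    show "vert d (Suc (steps \<sigma> d)) \<in> V" by (rule edge_in(3)[OF assms])
    assume "vert d (Suc (steps \<sigma> d)) = fst d"
    then have "vert d (Suc (steps \<sigma> d)) = vert d 0" by (simp add: vert_def)
    then show False using inj_onD[OF inj[OF \<sigma>(2)]] by fastforce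
  qed
  moreover have "finite (?B \<times> (V - {fst d}))"
    using finite_V finite_orientations[OF order_refl] by simp
  ultimately have "card ?A \<le> card (?B \<times> (V - {fst d}))" by (rule card_inj_on_le)
  also have "\<dots> = card ?B * (card V - 1)"
    using edge_in(3)[OF assms, of 0] by (simp add: card_cartesian_product vert_def card_Diff_singleton)
  finally show ?thesis unfolding sink_count_def by (simp add: mult.commute)
qed

end

section \<open>The degree-weighted count of orientations with a unique sink\<close>

context rotor_graph
begin

text \<open>
  The last vertex \<open>y\<close> to be a sink has a single outgoing edge in the outcome, so the outcome and \<open>y\<close>
  determine the final dart; running the rotor backwards from it until the initial sink appears
  recovers the whole walk.
\<close>

lemma sum_sink_count_singleton_le_rotor:
  "(\<Sum>v\<in>V. card (incident E {v}) * sink_count V E (\<lambda>X. X = {v}))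
     \<le> card V * (card V - 1) * sink_count V E (\<lambda>X. X = {})"
proof -
  let ?A = "\<lambda>v. {\<sigma> \<in> orientations E. sinks V E \<sigma> = {v}}"
  let ?B = "{\<sigma> \<in> orientations E. sinks V E \<sigma> = {}}"
  let ?D = "SIGMA v:V. ?A v \<times> incident E {v}"
  \<comment> \<open>For an outcome and its last sink \<open>y\<close>, only one edge leaves
    \<open>y\<close>, and \<open>head\<close> is the vertex reached last. For other arguments the
    choice is arbitrary; the size of \<open>C\<close> only needs a vertex of
    \<open>V\<close>.\<close>
  define head where "head \<sigma> y = \<sigma> (SOME e. e \<in> E \<and> y \<in> e \<and> \<sigma> e \<noteq> y)" for \<sigma> :: "'a orientation" and y
  \<comment> \<open>Sink-free orientation, last sink, first sink. The first sink is not the vertex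
    reached last, which gives the factor \<open>card V - 1\<close>.\<close>
  define C where "C = (SIGMA \<sigma>:?B. SIGMA y:V. V - {head \<sigma> y})"
  define final where "final v \<sigma> e = vert (v, e) (steps \<sigma> (v, e))" for v \<sigma> e
  define f where "f = (\<lambda>(v, \<sigma>, e). (outcome \<sigma> (v, e), final v \<sigma> e, v))"
  have fin: "finite ?B" "finite (?A v)" for v using finite_orientations[OF order_refl] by simp_all
  have D: "(v, e) \<in> darts" "sinks V E \<sigma> = {fst (v, e)}" "\<sigma> \<in> orientations E"
    if "(v, \<sigma>, e) \<in> ?D" for v \<sigma> e
    using that by (auto simp: darts_def incident_def)
  have out: "e' = edge (v, e) (steps \<sigma> (v, e))"
    if "(v, \<sigma>, e) \<in> ?D" "e' \<in> E" "final v \<sigma> e \<in> e'" "outcome \<sigma> (v, e) e' \<noteq> final v \<sigma> e" for v \<sigma> e e'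
    using walking_fresh[OF D(1)[OF that(1)] steps(1)[OF D(1,2)[OF that(1)]]] that(2-4)
    unfolding final_def outcome_def by blast
  have fresh: "inj_on (vert (v, e)) {..Suc (steps \<sigma> (v, e))}" if "(v, \<sigma>, e) \<in> ?D" for v \<sigma> e
    using walking_fresh[OF D(1)[OF that] steps(1)[OF D(1,2)[OF that]]] by blast
  have out_ex: "\<exists>e. e \<in> E \<and> y \<in> e \<and> \<sigma> e \<noteq> y" if "sinks V E \<sigma> = {}" "y \<in> V" for y and \<sigma> :: "'a orientation"
    using that mem_sinks[of y \<sigma>] by blast
  have "f ` ?D \<subseteq> C"
  proof
    fix x assume "x \<in> f ` ?D"
    then obtain v \<sigma> e where x: "x = f (v, \<sigma>, e)" and p: "(v, \<sigma>, e) \<in> ?D" by force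
    let ?k = "steps \<sigma> (v, e)" and ?d = "(v, e)"
    have B: "outcome \<sigma> ?d \<in> ?B"
      using steps(2)[OF D(1,2)[OF p]] walk_orientation[OF D(1)[OF p] D(3)[OF p]]
      unfolding outcome_def by blast
    have y: "final v \<sigma> e \<in> V" unfolding final_def by (rule edge_in(3)[OF D(1)[OF p]])
    \<comment> \<open>Some edge leaves \<open>final v \<sigma> e\<close> because the outcome is
      sink-free; \<open>out\<close> shows that it can only be the edge flipped last.\<close>
    have "(SOME e'. e' \<in> E \<and> final v \<sigma> e \<in> e' \<and> outcome \<sigma> ?d e' \<noteq> final v \<sigma> e) = edge ?d ?k"
      using someI_ex[OF out_ex[OF _ y, of "outcome \<sigma> ?d"]] B by (intro out[OF p]) auto
    then have "head (outcome \<sigma> ?d) (final v \<sigma> e) = vert ?d (Suc ?k)"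
      unfolding head_def by (simp add: outcome_def)
    moreover have "vert ?d (Suc ?k) \<noteq> vert ?d 0"
      using inj_onD[OF fresh[OF p], of "Suc ?k" 0] by auto
    ultimately have "v \<noteq> head (outcome \<sigma> ?d) (final v \<sigma> e)" by (auto simp: vert_def)
    then show "x \<in> C" using B y p by (simp add: x f_def C_def)
  qed
  moreover have "inj_on f ?D"
  proof (rule inj_onI)
    fix p p' assume pp: "p \<in> ?D" "p' \<in> ?D" "f p = f p'"
    obtain v \<sigma> e v' \<sigma>' e' where p: "p = (v, \<sigma>, e)" "p' = (v', \<sigma>', e')" by (cases p, cases p') auto
    have v: "v' = v" and y: "final v \<sigma> e = final v \<sigma>' e'"
      and o: "outcome \<sigma> (v, e) = outcome \<sigma>' (v, e')"
      using pp(3) by (auto simp: p f_def)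
    have P: "(v, \<sigma>, e) \<in> ?D" "(v, \<sigma>', e') \<in> ?D" using pp(1,2) by (simp_all only: p v)
    let ?d = "(v, e)" and ?d' = "(v, e')"
    let ?k = "steps \<sigma> ?d" and ?k' = "steps \<sigma>' ?d'"
    have d: "?d \<in> darts" "?d' \<in> darts" using D(1) P by blast+
    have yV: "final v \<sigma> e \<in> V" unfolding final_def by (rule edge_in(3)[OF d(1)])
    obtain e0 where e0: "e0 \<in> E" "final v \<sigma> e \<in> e0" "outcome \<sigma> ?d e0 \<noteq> final v \<sigma> e"
      using out_ex[OF steps(2)[OF D(1,2)[OF P(1)]] yV] by blast
    have "e0 = edge ?d ?k" by (rule out[OF P(1) e0])
    moreover have "e0 = edge ?d' ?k'" using e0 unfolding y o by (rule out[OF P(2)])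
    ultimately have "edge ?d ?k = edge ?d' ?k'" by simp
    then have last: "(rotor_step ^^ ?k) ?d = (rotor_step ^^ ?k') ?d'"
      using y unfolding final_def edge_def vert_def by (intro prod_eqI)
    \<comment> \<open>Run backwards from the common final dart: if one walk were longer, the other's
      initial dart would lie strictly inside it, and it would return to the shared first
      vertex.\<close>
    have less: False
      if "i < j" "(rotor_step ^^ i) c = (rotor_step ^^ j) c'" "inj_on (vert c') {..Suc j}"
        "c \<in> darts" "c' \<in> darts" "fst c = fst c'" for i j c c'
    proof -
      have "(rotor_step ^^ j) c' = (rotor_step ^^ (i + (j - i))) c'" using that(1) by simp
      then have "(rotor_step ^^ i) c = (rotor_step ^^ i) ((rotor_step ^^ (j - i)) c')"
        using that(2) unfolding funpow_add by simp
      then have "c = (rotor_step ^^ (j - i)) c'"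
        by (rule inj_onD[OF inj_funpow_rotor_step _ that(4) funpow_darts[OF that(5)]])
      then have "vert c' (j - i) = vert c' 0" using that(6) by (simp add: vert_def)
      then have "j - i = 0" by (rule inj_onD[OF that(3)]) auto
      then show False using that(1) by simp
    qed
    have k: "?k = ?k'"
      using less[of ?k ?k' ?d ?d', OF _ last fresh[OF P(2)] d]
        less[of ?k' ?k ?d' ?d, OF _ last[symmetric] fresh[OF P(1)] d(2,1)]
      by (metis fst_conv linorder_neqE_nat)
    have dd: "?d = ?d'"
      using last unfolding k by (rule inj_onD[OF inj_funpow_rotor_step _ d])
    have "\<sigma> = \<sigma>'"
      using outcome_inj[OF d(1) D(2)[OF P(1)], of \<sigma>'] D(2)[OF P(2)] k o dd by simp
    then show "p = p'" using dd by (simp add: p v)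
  qed
  moreover have "finite C" unfolding C_def using fin finite_V by auto
  ultimately have "card ?D \<le> card C" using card_inj_on_le by blast
  moreover have "card ?D = (\<Sum>v\<in>V. card (incident E {v}) * sink_count V E (\<lambda>X. X = {v}))"
    using fin finite_V finite_incident
    by (simp add: card_SigmaI card_cartesian_product sink_count_def mult.commute)
  moreover have "card C = card V * (card V - 1) * sink_count V E (\<lambda>X. X = {})"
  proof -
    have "head \<sigma> y \<in> V" if "\<sigma> \<in> ?B" "y \<in> V" for \<sigma> y
    proof -
      let ?e = "SOME e. e \<in> E \<and> y \<in> e \<and> \<sigma> e \<noteq> y"
      have "?e \<in> E" using someI_ex[OF out_ex[of \<sigma> y]] that by blast
      then show ?thesis
        unfolding head_def using head_in[of \<sigma> E ?e] edge_subset[of ?e] that by blast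
    qed
    then have "card (V - {head \<sigma> y}) = card V - 1" if "\<sigma> \<in> ?B" "y \<in> V" for \<sigma> y
      using that by (simp add: card_Diff_singleton)
    then have "card (SIGMA y:V. V - {head \<sigma> y}) = card V * (card V - 1)" if "\<sigma> \<in> ?B" for \<sigma>
      using that finite_V by (simp add: card_SigmaI)
    then have "card C = (\<Sum>\<sigma>\<in>?B. card V * (card V - 1))"
      unfolding C_def using fin(1) finite_V by (subst card_SigmaI) auto
    then show ?thesis by (simp add: sink_count_def)
  qed
  ultimately show ?thesis by simp
qed

end

subsection \<open>Leaves\<close>

locale leaf_graph = graph V E for V :: "'a set" and E +
  fixes u w :: 'a
  assumes leaf: "incident E {u} = {{u, w}}"
begin

definition V' :: "'a set" where "V' = V - {u}"
definition E' :: "'a set set" where "E' = E - {{u, w}}"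

lemma leaf_edge: "{u, w} \<in> E" "u \<noteq> w" "u \<in> V" "w \<in> V"
proof -
  show "{u, w} \<in> E" using leaf by (auto simp: incident_def)
  then show "u \<noteq> w" "u \<in> V" "w \<in> V" using card_edge[of "{u, w}"] edge_subset[of "{u, w}"] by auto
qed

lemma leaf_only: "e \<in> E \<Longrightarrow> u \<in> e \<Longrightarrow> e = {u, w}"
  using leaf by (auto simp: incident_def)

lemma simple_pruned: "simple_graph V' E'"
  using simple leaf_only by (auto simp: simple_graph_def V'_def E'_def)

lemma pruned_orientation_upd:
  assumes "\<sigma> \<in> orientations E'" "h \<in> {u, w}"
  shows "\<sigma>({u, w} := h) \<in> orientations E"
  using assms leaf_edge by (auto simp: orientations_def PiE_def extensional_def E'_def)

lemma mem_sinks_upd: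
  "v \<in> sinks V E (\<sigma>({u, w} := h)) \<longleftrightarrow>
     v \<in> V \<and> (v \<in> {u, w} \<longrightarrow> h = v) \<and> (\<forall>e\<in>E'. v \<in> e \<longrightarrow> \<sigma> e = v)"
proof -
  have E: "E = insert {u, w} E'" "{u, w} \<notin> E'" using leaf_edge(1) by (auto simp: E'_def)
  then have "(\<sigma>({u, w} := h)) e = \<sigma> e" if "e \<in> E'" for e using that by auto
  then have "(\<forall>e\<in>insert {u, w} E'. v \<in> e \<longrightarrow> (\<sigma>({u, w} := h)) e = v)
      \<longleftrightarrow> (v \<in> {u, w} \<longrightarrow> h = v) \<and> (\<forall>e\<in>E'. v \<in> e \<longrightarrow> \<sigma> e = v)"
    by (simp add: fun_upd_same del: fun_upd_apply cong: ball_cong)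
  then show ?thesis unfolding mem_sinks E(1)[symmetric] by blast
qed

lemma mem_sinks_pruned: "v \<in> sinks V' E' \<sigma> \<longleftrightarrow> v \<in> V \<and> v \<noteq> u \<and> (\<forall>e\<in>E'. v \<in> e \<longrightarrow> \<sigma> e = v)"
  unfolding sinks_def is_sink_def V'_def by blast

lemma leaf_pruned: "e \<in> E' \<Longrightarrow> u \<notin> e"
  using leaf_only[of e] by (auto simp: E'_def)

lemma sinks_upd_neighbour: "sinks V E (\<sigma>({u, w} := w)) = sinks V' E' \<sigma>"
  unfolding set_eq_iff mem_sinks_upd mem_sinks_pruned using leaf_edge(2) by blast

text \<open>With the pendant edge pointing to \<open>u\<close>, the leaf is a sink and
  \<open>w\<close> has an outgoing edge; the other vertices do not notice it.\<close>

lemma sinks_upd_leaf: "sinks V E (\<sigma>({u, w} := u)) = insert u (sinks V' E' \<sigma> - {w})"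
  unfolding set_eq_iff mem_sinks_upd insert_iff Diff_iff mem_sinks_pruned
  using leaf_edge(2,3) leaf_pruned by blast

text \<open>Split by the direction of the pendant edge: towards \<open>w\<close> it leaves the sinks
  of the pruned graph unchanged, towards \<open>u\<close> it adds \<open>u\<close> and removes
  \<open>w\<close>.\<close>

lemma sink_count_leaf:
  "sink_count V E P = sink_count V' E' P + sink_count V' E' (\<lambda>X. P (insert u (X - {w})))"
proof -
  let ?e = "{u, w}"
  let ?A1 = "{\<sigma> \<in> orientations E'. P (sinks V' E' \<sigma>)}"
  let ?A2 = "{\<sigma> \<in> orientations E'. P (insert u (sinks V' E' \<sigma> - {w}))}"
  let ?up = "\<lambda>h \<sigma>. \<sigma>(?e := h)"
  have fin: "finite (orientations E')"
    by (rule finite_orientations) (auto simp: E'_def)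
  have inj: "inj_on (?up h) (orientations E')" for h
  proof (rule inj_onI)
    fix \<sigma> \<tau> assume *: "\<sigma> \<in> orientations E'" "\<tau> \<in> orientations E'" "\<sigma>(?e := h) = \<tau>(?e := h)"
    have "\<sigma> ?e = \<tau> ?e"
      using *(1,2) by (simp add: orientations_def PiE_def extensional_def E'_def)
    then show "\<sigma> = \<tau>" using *(3) by (metis fun_upd_idem_iff fun_upd_upd)
  qed
  have "{\<sigma> \<in> orientations E. P (sinks V E \<sigma>)} = ?up w ` ?A1 \<union> ?up u ` ?A2"
  proof
    show "?up w ` ?A1 \<union> ?up u ` ?A2 \<subseteq> {\<sigma> \<in> orientations E. P (sinks V E \<sigma>)}"
      using pruned_orientation_upd sinks_upd_neighbour sinks_upd_leaf by auto
    show "{\<sigma> \<in> orientations E. P (sinks V E \<sigma>)} \<subseteq> ?up w ` ?A1 \<union> ?up u ` ?A2"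
    proof
      fix \<sigma> assume \<sigma>: "\<sigma> \<in> {\<sigma> \<in> orientations E. P (sinks V E \<sigma>)}"
      define \<tau> where "\<tau> = \<sigma>(?e := undefined)"
      have \<tau>: "\<tau> \<in> orientations E'"
        using \<sigma> by (auto simp: \<tau>_def orientations_def PiE_def extensional_def E'_def)
      have eq: "\<tau>(?e := \<sigma> ?e) = \<sigma>" by (simp add: \<tau>_def)
      have "\<sigma> ?e \<in> ?e" using \<sigma> leaf_edge head_in by blast
      then consider "\<sigma> ?e = w" | "\<sigma> ?e = u" by blast
      then show "\<sigma> \<in> ?up w ` ?A1 \<union> ?up u ` ?A2"
      proof cases
        case 1
        then have \<sigma>': "\<tau>(?e := w) = \<sigma>" using eq by simp
        then have "\<tau> \<in> ?A1" using \<tau> \<sigma> sinks_upd_neighbour[of \<tau>] by simp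
        then show ?thesis using \<sigma>' by blast
      next
        case 2
        then have \<sigma>': "\<tau>(?e := u) = \<sigma>" using eq by simp
        then have "\<tau> \<in> ?A2" using \<tau> \<sigma> sinks_upd_leaf[of \<tau>] by simp
        then show ?thesis using \<sigma>' by blast
      qed
    qed
  qed
  moreover have "?up w ` ?A1 \<inter> ?up u ` ?A2 = {}"
  proof -
    have "\<sigma>(?e := w) \<noteq> \<tau>(?e := u)" for \<sigma> \<tau> :: "'a orientation"
      using leaf_edge(2) by (metis fun_upd_same)
    then show ?thesis by blast
  qed
  moreover have "card (?up w ` ?A1) = card ?A1" "card (?up u ` ?A2) = card ?A2"
    by (rule card_image, rule inj_on_subset[OF inj], blast)+
  ultimately show ?thesis
    unfolding sink_count_def using fin by (simp add: card_Un_disjoint)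
qed

lemma sinks_pruned: "u \<notin> sinks V' E' \<sigma>"
  by (simp add: sinks_def is_sink_def V'_def)

lemma sink_count_leaf_none: "sink_count V E (\<lambda>X. X = {}) = sink_count V' E' (\<lambda>X. X = {})"
  unfolding sink_count_leaf by (simp add: sink_count_def)

lemma sink_count_leaf_other:
  assumes "v \<noteq> u"
  shows "sink_count V E (\<lambda>X. X = {v}) = sink_count V' E' (\<lambda>X. X = {v})"
proof -
  have "insert u (X - {w}) \<noteq> {v}" for X using assms by blast
  then show ?thesis unfolding sink_count_leaf by (simp add: sink_count_def)
qed

lemma sink_count_leaf_self:
  "sink_count V E (\<lambda>X. X = {u}) = sink_count V' E' (\<lambda>X. X = {}) + sink_count V' E' (\<lambda>X. X = {w})"
proof -
  interpret pruned: graph V' E' by standard (rule simple_pruned)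
  have "sinks V' E' \<sigma> \<noteq> {u}" for \<sigma> using sinks_pruned[of \<sigma>] by auto
  then have "sink_count V' E' (\<lambda>X. X = {u}) = 0" by (simp add: sink_count_def)
  moreover have "sink_count V' E' (\<lambda>X. insert u (X - {w}) = {u}) = sink_count V' E' (\<lambda>X. X = {} \<or> X = {w})"
  proof (rule pruned.sink_count_cong)
    fix X assume "pruned.independent X"
    then have "u \<notin> X" using pruned.independentD by (auto simp: V'_def)
    then show "insert u (X - {w}) = {u} \<longleftrightarrow> X = {} \<or> X = {w}" by auto
  qed
  moreover have "sink_count V' E' (\<lambda>X. X = {}) + sink_count V' E' (\<lambda>X. X = {w})
      = sink_count V' E' (\<lambda>X. X = {} \<or> X = {w})"
    by (rule pruned.sink_count_add) simp
  ultimately show ?thesis unfolding sink_count_leaf[of "\<lambda>X. X = {u}"] by simp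
qed

lemma card_incident_leaf:
  assumes "v \<in> V'"
  shows "card (incident E {v}) = card (incident E' {v}) + (if v = w then 1 else 0)"
proof (cases "v = w")
  case True
  have "incident E {v} = insert {u, w} (incident E' {v})" "{u, w} \<notin> incident E' {v}"
    using True leaf_edge by (auto simp: incident_def E'_def)
  moreover have "finite (incident E' {v})"
    by (rule finite_subset[OF _ finite_E]) (auto simp: incident_def E'_def)
  ultimately show ?thesis using True by simp
next
  case False
  then have "incident E {v} = incident E' {v}"
    using assms by (auto simp: incident_def E'_def V'_def)
  then show ?thesis using False by simp
qed

end

text \<open>The bounds for single vertices are carried through the induction because pruning a leaf
  adds terms that involve only \<open>N {w}\<close> of the pruned graph, which the weighted sum does
  not control well enough. Degree zero is excluded by the existence of a sink-free
  orientation.\<close>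

lemma sink_count_singleton_bounds:
  "simple_graph V E \<Longrightarrow> sink_count V E (\<lambda>X. X = {}) > 0 \<Longrightarrow>
    (\<forall>v\<in>V. sink_count V E (\<lambda>X. X = {v}) \<le> (card V - 1) * sink_count V E (\<lambda>X. X = {})) \<and>
    (\<Sum>v\<in>V. card (incident E {v}) * sink_count V E (\<lambda>X. X = {v}))
      \<le> card V * (card V - 1) * sink_count V E (\<lambda>X. X = {})"
proof (induction "card V" arbitrary: V E rule: less_induct)
  case less
  interpret graph V E by standard (rule less.prems(1))
  let ?N = "sink_count V E (\<lambda>X. X = {})"
  have deg_pos: "card (incident E {v}) > 0" if "v \<in> V" for v
  proof -
    obtain \<sigma> where "sinks V E \<sigma> = {}"
      using less.prems(2) unfolding sink_count_def card_gt_0_iff by blast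
    then have "incident E {v} \<noteq> {}" using that mem_sinks[of v \<sigma>] by (auto simp: incident_def)
    then show ?thesis using finite_incident by (simp add: card_gt_0_iff)
  qed
  show ?case
  proof (cases "\<forall>v\<in>V. card (incident E {v}) \<ge> 2")
    case True
    have "\<exists>\<rho>. inj_on \<rho> (incident E {v}) \<and> (\<forall>e\<in>incident E {v}. \<rho> e \<in> incident E {v} \<and> \<rho> e \<noteq> e)" for v
    proof (cases "v \<in> V")
      case True
      with \<open>\<forall>v\<in>V. card (incident E {v}) \<ge> 2\<close> show ?thesis
        by (intro ex_fixpoint_free_permutation finite_incident) blast
    next
      case False
      then have "incident E {v} = {}" using edge_subset by (auto simp: incident_def)
      then show ?thesis by simp
    qed
    then obtain rotor where rotor: "\<And>v. inj_on (rotor v) (incident E {v}) \<and>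
        (\<forall>e\<in>incident E {v}. rotor v e \<in> incident E {v} \<and> rotor v e \<noteq> e)"
      by metis
    interpret rotor_graph V E rotor by standard (use rotor in blast)+
    have "sink_count V E (\<lambda>X. X = {v}) \<le> (card V - 1) * ?N" if "v \<in> V" for v
    proof -
      obtain e where "e \<in> incident E {v}" using deg_pos[OF \<open>v \<in> V\<close>] by fastforce
      then have "(v, e) \<in> darts" by (auto simp: darts_def incident_def)
      from sink_count_singleton_le[OF this] show ?thesis by simp
    qed
    then show ?thesis using sum_sink_count_singleton_le_rotor by blast
  next
    case False
    then obtain u where u: "u \<in> V" "card (incident E {u}) < 2" by (auto simp: not_le)
    then have "card (incident E {u}) = 1" using deg_pos[OF u(1)] by linarith
    then obtain e where e: "incident E {u} = {e}" by (auto simp: card_1_singleton_iff)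
    then have "e \<in> E" "u \<in> e" by (auto simp: incident_def)
    then obtain w where "e = {u, w}"
      using card_edge[of e] by (auto simp: card_2_iff)
    with e interpret leaf_graph V E u w by unfold_locales simp
    let ?N' = "\<lambda>v. sink_count V' E' (\<lambda>X. X = {v})"
    have w: "w \<in> V'" using leaf_edge by (simp add: V'_def)
    have finV': "finite V'" using finite_V by (simp add: V'_def)
    obtain k where k: "card V' = Suc k" using w finV' by (cases "card V'") auto
    have V: "insert u V' = V" "u \<notin> V'" using u by (auto simp: V'_def)
    have n: "card V = Suc (Suc k)"
      using card_insert_disjoint[OF finV' V(2)] unfolding V(1) k .
    have small: "card V' < card V" using k n by simp
    have none: "sink_count V' E' (\<lambda>X. X = {}) = ?N" by (rule sink_count_leaf_none[symmetric])
    have IH: "\<forall>v\<in>V'. ?N' v \<le> k * ?N"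
      "(\<Sum>v\<in>V'. card (incident E' {v}) * ?N' v) \<le> Suc k * k * ?N"
      using less.hyps[OF small simple_pruned] less.prems(2) unfolding none k by simp_all
    have "sink_count V E (\<lambda>X. X = {v}) \<le> (card V - 1) * ?N" if "v \<in> V" for v
    proof (cases "v = u")
      case True
      have "sink_count V E (\<lambda>X. X = {u}) = ?N + ?N' w" unfolding sink_count_leaf_self none ..
      also have "\<dots> \<le> ?N + k * ?N" using IH(1) w by simp
      finally show ?thesis using True n by simp
    next
      case False
      then have "?N' v \<le> k * ?N" using IH(1) that V by blast
      then show ?thesis using sink_count_leaf_other[OF False] n by simp
    qed
    moreover have "(\<Sum>v\<in>V. card (incident E {v}) * sink_count V E (\<lambda>X. X = {v}))
        \<le> card V * (card V - 1) * ?N"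
    proof -
      have "(\<Sum>v\<in>V. card (incident E {v}) * sink_count V E (\<lambda>X. X = {v}))
          = (?N + ?N' w) + (\<Sum>v\<in>V'. card (incident E {v}) * sink_count V E (\<lambda>X. X = {v}))"
        using sum.insert[OF finV' V(2), of "\<lambda>v. card (incident E {v}) * sink_count V E (\<lambda>X. X = {v})"]
        unfolding V(1) leaf sink_count_leaf_self none by simp
      also have "(\<Sum>v\<in>V'. card (incident E {v}) * sink_count V E (\<lambda>X. X = {v}))
          = (\<Sum>v\<in>V'. card (incident E' {v}) * ?N' v + (if v = w then ?N' v else 0))"
      proof (rule sum.cong[OF refl])
        fix v assume v: "v \<in> V'"
        then have "v \<noteq> u" using V(2) by blast
        then show "card (incident E {v}) * sink_count V E (\<lambda>X. X = {v})
            = card (incident E' {v}) * ?N' v + (if v = w then ?N' v else 0)"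
          by (simp add: card_incident_leaf[OF v] sink_count_leaf_other)
      qed
      also have "\<dots> = (\<Sum>v\<in>V'. card (incident E' {v}) * ?N' v) + ?N' w"
        using w finV' by (simp add: sum.distrib)
      \<comment> \<open>The first bracket is the leaf's own term; the last summand comes from the
        pendant edge in the degree of \<open>w\<close>.\<close>
      also have "(?N + ?N' w) + \<dots> \<le> (?N + k * ?N) + (Suc k * k * ?N + k * ?N)"
        using IH w by (intro add_mono) auto
      \<comment> \<open>With \<open>card V = k + 2\<close> this compares
        \<open>k * k + 3 * k + 1\<close> with \<open>(k + 2) * (k + 1)\<close>, one larger.\<close>
      also have "\<dots> \<le> card V * (card V - 1) * ?N"
        unfolding n by (simp add: algebra_simps)
      finally show ?thesis .
    qed
    ultimately show ?thesis by blast
  qed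
qed

subsection \<open>Sink-free orientations\<close>

context graph
begin

text \<open>Requiring the outgoing edges to stay inside \<open>W\<close> lets edges that leave
  \<open>W\<close> be reoriented without creating sinks in \<open>W\<close>.\<close>

definition self_sufficient :: "'a orientation \<Rightarrow> 'a set \<Rightarrow> bool" where
  "self_sufficient \<sigma> W \<longleftrightarrow> (\<forall>v\<in>W. \<exists>e\<in>E. e \<subseteq> W \<and> v \<in> e \<and> \<sigma> e \<noteq> v)"

text \<open>Orient the cycle cyclically and every other edge arbitrarily.\<close>

lemma ex_self_sufficient_cycle:
  assumes "is_cycle E vs"
  shows "\<exists>\<sigma>\<in>orientations E. self_sufficient \<sigma> (set vs)"
proof -
  let ?n = "length vs"
  let ?s = "\<lambda>i. Suc i mod ?n"
  define f where "f i = {vs ! i, vs ! ?s i}" for i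
  have n: "?n \<ge> 3" and dist: "distinct vs" and fE: "\<And>i. i < ?n \<Longrightarrow> f i \<in> E"
    using assms by (auto simp: is_cycle_def f_def)
  have s_less: "?s i < ?n" for i using n by (intro mod_less_divisor) linarith
  have nth_inj: "i = j" if "vs ! i = vs ! j" "i < ?n" "j < ?n" for i j
    using nth_eq_iff_index_eq[OF dist that(2,3)] that(1) by simp
  \<comment> \<open>Two positions with the same edge would be successors of each other, which length
    at least three rules out.\<close>
  have f_inj: "i = j" if ij: "i < ?n" "j < ?n" "f i = f j" for i j
  proof (rule ccontr)
    assume "i \<noteq> j"
    then have "vs ! i \<noteq> vs ! j" using nth_inj[OF _ ij(1,2)] by blast
    then have "vs ! i = vs ! ?s j" "vs ! ?s i = vs ! j"
      using ij(3) by (auto simp: f_def doubleton_eq_iff)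
    then have "i = ?s j" "?s i = j" using nth_inj ij s_less by blast+
    then show False using ij n by (auto simp: mod_Suc split: if_splits)
  qed
  define \<sigma> where "\<sigma> e = (if e \<notin> E then undefined else if \<exists>i<?n. e = f i
      then vs ! ?s (THE i. i < ?n \<and> e = f i) else SOME v. v \<in> e)" for e
  have \<sigma>_f: "\<sigma> (f i) = vs ! ?s i" if i: "i < ?n" for i
  proof -
    have "(THE j. j < ?n \<and> f i = f j) = i"
      using i f_inj by (intro the_equality) blast+
    then show ?thesis using i fE[OF i] unfolding \<sigma>_def by auto
  qed
  have "\<sigma> e \<in> e" if e: "e \<in> E" for e
  proof (cases "\<exists>i<?n. e = f i")
    case True
    then show ?thesis using \<sigma>_f by (auto simp: f_def)
  next
    case False
    have "e \<noteq> {}" using card_edge[OF e] by auto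
    then show ?thesis unfolding \<sigma>_def if_not_P[OF False] using e by (simp add: some_in_eq)
  qed
  then have "\<sigma> \<in> orientations E"
    unfolding orientations_def by (intro PiE_I) (auto simp: \<sigma>_def)
  moreover have "self_sufficient \<sigma> (set vs)"
    unfolding self_sufficient_def
  proof
    fix v assume "v \<in> set vs"
    then obtain i where i: "i < ?n" "v = vs ! i" by (auto simp: in_set_conv_nth)
    have "i \<noteq> ?s i" using i(1) n by (auto simp: mod_Suc)
    then have "\<sigma> (f i) \<noteq> v" using \<sigma>_f[OF i(1)] i nth_inj[OF _ i(1) s_less] by metis
    moreover have "f i \<subseteq> set vs" "v \<in> f i" using i s_less by (auto simp: f_def)
    ultimately show "\<exists>e\<in>E. e \<subseteq> set vs \<and> v \<in> e \<and> \<sigma> e \<noteq> v" using fE[OF i(1)] by blast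
  qed
  ultimately show ?thesis by blast
qed

text \<open>Grow \<open>W\<close> by one vertex at a time: connectedness supplies an edge leaving
  \<open>W\<close>, and its outer end is added.\<close>

lemma ex_self_sufficient:
  assumes con: "connected_graph V E"
  shows "W \<subseteq> V \<Longrightarrow> W \<noteq> {} \<Longrightarrow> \<sigma> \<in> orientations E \<Longrightarrow> self_sufficient \<sigma> W \<Longrightarrow>
    \<exists>\<tau>\<in>orientations E. self_sufficient \<tau> V"
proof (induction "card (V - W)" arbitrary: W \<sigma> rule: less_induct)
  case less
  show ?case
  proof (cases "W = V")
    case False
    then obtain a b where ab: "a \<in> W" "b \<in> V" "b \<notin> W" using less.prems by blast
    have "\<exists>x y. x \<in> W \<and> y \<notin> W \<and> {x, y} \<in> E"
    proof (rule ccontr)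
      assume closed: "\<not> ?thesis"
      have "(a, b) \<in> {(x, y). {x, y} \<in> E}\<^sup>*"
        using con ab less.prems(1) unfolding connected_graph_def by blast
      then have "b \<in> W"
        by (induction rule: rtrancl_induct) (use ab(1) closed in auto)
      then show False using ab by simp
    qed
    then obtain x y where xy: "x \<in> W" "y \<notin> W" "{x, y} \<in> E" by blast
    \<comment> \<open>Pointing the edge back into \<open>W\<close> gives \<open>y\<close> an
      outgoing edge; no edge inside \<open>W\<close> changes.\<close>
    let ?\<sigma> = "\<sigma>({x, y} := x)" and ?W = "insert y W"
    have y: "y \<in> V" using edge_subset[OF xy(3)] by simp
    have "?\<sigma> \<in> orientations E"
      using less.prems(3) xy(3) by (auto simp: orientations_def PiE_def extensional_def)
    moreover have "self_sufficient ?\<sigma> ?W"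
      unfolding self_sufficient_def
    proof
      fix v assume v: "v \<in> ?W"
      show "\<exists>e\<in>E. e \<subseteq> ?W \<and> v \<in> e \<and> ?\<sigma> e \<noteq> v"
      proof (cases "v = y")
        case True
        then show ?thesis using xy by (intro bexI[of _ "{x, y}"]) auto
      next
        case False
        then obtain e where e: "e \<in> E" "e \<subseteq> W" "v \<in> e" "\<sigma> e \<noteq> v"
          using v less.prems(4) unfolding self_sufficient_def by blast
        then have "e \<noteq> {x, y}" using xy by blast
        then show ?thesis using e by (intro bexI[of _ e]) auto
      qed
    qed
    moreover have "card (V - ?W) < card (V - W)"
      using y xy finite_V by (intro psubset_card_mono) auto
    ultimately show ?thesis using less.prems y by (intro less.hyps[of ?W ?\<sigma>]) auto
  qed (use less.prems in blast)
qed

lemma sink_free_orientation_exists: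
  assumes "connected_graph V E" "\<not> is_tree V E"
  shows "sink_count V E (\<lambda>X. X = {}) > 0"
proof -
  obtain vs where vs: "is_cycle E vs" using assms by (auto simp: is_tree_def)
  have "set vs \<subseteq> V"
  proof
    fix v assume "v \<in> set vs"
    then obtain i where "i < length vs" "v = vs ! i" by (auto simp: in_set_conv_nth)
    then have "{v, vs ! ((i + 1) mod length vs)} \<in> E" using vs by (simp add: is_cycle_def)
    then show "v \<in> V" using edge_subset by blast
  qed
  moreover have "set vs \<noteq> {}" using vs by (auto simp: is_cycle_def)
  ultimately obtain \<tau> where \<tau>: "\<tau> \<in> orientations E" "self_sufficient \<tau> V"
    using ex_self_sufficient_cycle[OF vs] ex_self_sufficient[OF assms(1)] by blast
  have "v \<notin> sinks V E \<tau>" for v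
    using \<tau>(2) mem_sinks[of v \<tau>] unfolding self_sufficient_def by blast
  then have "{\<sigma> \<in> orientations E. sinks V E \<sigma> = {}} \<noteq> {}" using \<tau>(1) by blast
  then show ?thesis
    unfolding sink_count_def using finite_orientations[OF order_refl] by (simp add: card_gt_0_iff)
qed

subsection \<open>The loop\<close>

text \<open>The probability that the first \<open>t\<close> rounds, started at \<open>\<sigma>\<close>, all find a sink.\<close>

primrec running :: "nat \<Rightarrow> 'a orientation \<Rightarrow> real" where
  "running 0 \<sigma> = 1"
| "running (Suc t) \<sigma> = (if sinks V E \<sigma> = {} then 0 else redraw_mean (running t) \<sigma>)"

lemma redraw_mean_mono:
  assumes "\<And>\<sigma>. g \<sigma> \<le> h \<sigma>" shows "redraw_mean g \<sigma> \<le> redraw_mean h \<sigma>"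
  unfolding redraw_mean_def using assms by (intro divide_right_mono sum_mono) auto

lemma sink_edges_subset: "sink_edges V E \<sigma> \<subseteq> E"
  by (auto simp: sink_edges_def)

lemma redraw_mean_const: "redraw_mean (\<lambda>_. c) \<sigma> = c"
  by (simp add: redraw_mean_def card_orientations[OF sink_edges_subset])

lemma redraw_mean_add: "redraw_mean (\<lambda>\<sigma>. g \<sigma> + h \<sigma>) \<sigma> = redraw_mean g \<sigma> + redraw_mean h \<sigma>"
  by (simp add: redraw_mean_def sum.distrib add_divide_distrib)

lemma redraw_mean_mult: "redraw_mean (\<lambda>\<sigma>. c * g \<sigma>) \<sigma> = c * redraw_mean g \<sigma>"
  by (simp add: redraw_mean_def flip: sum_distrib_left)

lemma running_bounds: "0 \<le> running t \<sigma>" "running t \<sigma> \<le> 1"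
proof (induction t arbitrary: \<sigma>)
  case (Suc t)
  { case 1
    show ?case using redraw_mean_mono[of "\<lambda>_. 0" "running t" \<sigma>] Suc(1) by (simp add: redraw_mean_const) }
  { case 2
    show ?case using redraw_mean_mono[of "running t" "\<lambda>_. 1" \<sigma>] Suc(2) by (simp add: redraw_mean_const) }
qed simp_all

lemma draws_nonneg: "0 \<le> draws t \<sigma>"
proof (induction t arbitrary: \<sigma>)
  case (Suc t)
  then show ?case using redraw_mean_mono[of "\<lambda>_. 0" "draws t" \<sigma>] by (simp add: redraw_mean_const)
qed simp

text \<open>
  Truncating the cost at \<open>M\<close> makes it a bounded function for which the recursion of the loop can be
  unrolled finitely often; the runs still active after \<open>t\<close> rounds contribute at most \<open>M\<close> each.
\<close>

definition capped_draws :: "nat \<Rightarrow> ('a orientation \<times> nat) option \<Rightarrow> ennreal" where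
  "capped_draws M r = (case r of None \<Rightarrow> of_nat M | Some (\<sigma>, k) \<Rightarrow> of_nat (min k M))"

lemma nn_integral_random_orientation:
  assumes "F \<subseteq> E" "\<And>\<tau>. 0 \<le> g \<tau>"
  shows "(\<integral>\<^sup>+ \<tau>. ennreal (g \<tau>) \<partial>measure_pmf (random_orientation F))
    = ennreal ((\<Sum>\<tau>\<in>orientations F. g \<tau>) / 2 ^ card F)"
proof -
  have "(\<integral>\<^sup>+ \<tau>. ennreal (g \<tau>) \<partial>measure_pmf (random_orientation F))
      = (\<Sum>\<tau>\<in>orientations F. ennreal (g \<tau>)) / ennreal (2 ^ card F)"
    unfolding random_orientation_eq[OF assms(1)]
    using nn_integral_pmf_of_set[OF orientations_nonempty finite_orientations, OF assms(1) assms(1)]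
    by (simp add: card_orientations[OF assms(1)] ennreal_of_nat_eq_real_of_nat)
  also have "(\<Sum>\<tau>\<in>orientations F. ennreal (g \<tau>)) = ennreal (\<Sum>\<tau>\<in>orientations F. g \<tau>)"
    using assms(2) by (intro sum_ennreal) auto
  also have "\<dots> / ennreal (2 ^ card F) = ennreal ((\<Sum>\<tau>\<in>orientations F. g \<tau>) / 2 ^ card F)"
    using assms(2) by (intro divide_ennreal sum_nonneg) auto
  finally show ?thesis .
qed

text \<open>Unroll \<open>t\<close> rounds of the fixed point. The induction varies the counter
  \<open>k\<close>, which collects the draws made so far; at \<open>t = 0\<close> the whole
  remaining cost is bounded by the cap.\<close>

lemma capped_draws_pop_sinks:
  "(\<integral>\<^sup>+ r. capped_draws M r \<partial>measure_pmf (pop_sinks V E \<sigma> k))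
    \<le> ennreal (k + draws t \<sigma> + M * running t \<sigma>)"
proof (induction t arbitrary: \<sigma> k)
  case 0
  have "(\<integral>\<^sup>+ r. capped_draws M r \<partial>measure_pmf (pop_sinks V E \<sigma> k))
      \<le> (\<integral>\<^sup>+ r. of_nat M \<partial>measure_pmf (pop_sinks V E \<sigma> k))"
    by (intro nn_integral_mono) (auto simp: capped_draws_def split: option.splits)
  also have "\<dots> = ennreal M"
    by (simp add: ennreal_of_nat_eq_real_of_nat)
  also have "\<dots> \<le> ennreal (k + draws 0 \<sigma> + M * running 0 \<sigma>)" by (intro ennreal_leI) simp
  finally show ?case .
next
  case (Suc t)
  show ?case
  proof (cases "sinks V E \<sigma> = {}")
    case True
    then have "\<not> (\<exists>v. is_sink V E \<sigma> v)" by (simp add: sinks_def)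
    then have "pop_sinks V E \<sigma> k = return_spmf (\<sigma>, k)" by (simp add: pop_sinks.simps)
    then have "(\<integral>\<^sup>+ r. capped_draws M r \<partial>measure_pmf (pop_sinks V E \<sigma> k)) = of_nat (min k M)"
      by (simp add: capped_draws_def)
    also have "\<dots> \<le> ennreal k" by (simp add: ennreal_of_nat_eq_real_of_nat)
    finally show ?thesis using True by simp
  next
    case False
    let ?F = "sink_edges V E \<sigma>"
    let ?g = "\<lambda>\<sigma>. (k + card ?F) + draws t \<sigma> + M * running t \<sigma>"
    have "\<exists>v. is_sink V E \<sigma> v" using False by (auto simp: sinks_def)
    then have "pop_sinks V E \<sigma> k = bind_pmf (random_orientation ?F)
        (\<lambda>\<tau>. pop_sinks V E (override_on \<sigma> \<tau> ?F) (k + card ?F))"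
      by (subst pop_sinks.simps) (simp add: bind_spmf_of_pmf)
    then have "(\<integral>\<^sup>+ r. capped_draws M r \<partial>measure_pmf (pop_sinks V E \<sigma> k))
        = (\<integral>\<^sup>+ \<tau>. \<integral>\<^sup>+ r. capped_draws M r
            \<partial>measure_pmf (pop_sinks V E (override_on \<sigma> \<tau> ?F) (k + card ?F))
          \<partial>measure_pmf (random_orientation ?F))"
      by simp
    also have "\<dots> \<le> (\<integral>\<^sup>+ \<tau>. ennreal (?g (override_on \<sigma> \<tau> ?F)) \<partial>measure_pmf (random_orientation ?F))"
      by (rule nn_integral_mono) (rule Suc.IH)
    also have "\<dots> = ennreal (redraw_mean ?g \<sigma>)"
      unfolding redraw_mean_def
      by (rule nn_integral_random_orientation[OF sink_edges_subset])
         (simp add: draws_nonneg running_bounds)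
    also have "redraw_mean ?g \<sigma> = k + draws (Suc t) \<sigma> + M * running (Suc t) \<sigma>"
      using False by (simp add: redraw_mean_add redraw_mean_mult redraw_mean_const)
    finally show ?thesis .
  qed
qed

end

section \<open>Almost sure termination and removal of the truncation\<close>

context sink_free_graph
begin

text \<open>An isolated vertex would be a sink of every orientation, so every sink has an edge to
  redraw.\<close>

lemma card_sink_edges_pos:
  assumes "sinks V E \<sigma> \<noteq> {}" shows "card (sink_edges V E \<sigma>) \<ge> 1"
proof -
  obtain v where v: "v \<in> sinks V E \<sigma>" using assms by blast
  obtain \<tau> where "sinks V E \<tau> = {}"
    using sink_free unfolding sink_count_def card_gt_0_iff by blast
  then obtain e where "e \<in> E" "v \<in> e" using v mem_sinks[of v \<tau>] sinks_subset[of \<sigma>] by blast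
  then have "e \<in> sink_edges V E \<sigma>" using v by (auto simp: sink_edges_def sinks_def)
  then have "card (sink_edges V E \<sigma>) > 0"
    using finite_subset[OF sink_edges_subset finite_E] by (auto simp: card_gt_0_iff)
  then show ?thesis by simp
qed

text \<open>A Markov-type bound: each round that finds a sink costs at least one draw, so surviving
  \<open>t\<close> rounds means at least \<open>t\<close> draws.\<close>

lemma running_le_draws: "t * running t \<sigma> \<le> draws t \<sigma>"
proof (induction t arbitrary: \<sigma>)
  case (Suc t)
  show ?case
  proof (cases "sinks V E \<sigma> = {}")
    case False
    have "t * redraw_mean (running t) \<sigma> \<le> redraw_mean (draws t) \<sigma>"
      using redraw_mean_mono[of "\<lambda>\<sigma>. t * running t \<sigma>" "draws t" \<sigma>] Suc.IH
      by (simp add: redraw_mean_mult)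
    moreover have "redraw_mean (running t) \<sigma> \<le> 1"
      using running_bounds(2)[of "Suc t" \<sigma>] False by simp
    moreover have "1 \<le> real (card (sink_edges V E \<sigma>))"
      using card_sink_edges_pos[OF False] by linarith
    ultimately show ?thesis using False by (simp add: algebra_simps)
  qed simp
qed simp

text \<open>The case \<open>A = {}\<close>, where every orientation is a permitted start and the
  subtracted sum is zero.\<close>

lemma sum_draws_le_mean: "(\<Sum>\<sigma>\<in>orientations E. draws t \<sigma>) \<le> mean_draws * 2 ^ card E"
proof -
  have "sink_count V E (\<lambda>X. X \<inter> {} = {}) = 2 ^ card E"
    by (simp add: sink_count_def card_orientations)
  moreover have "sink_count V E (\<lambda>X. X \<inter> {} = {v}) = 0" for v
    by (simp add: sink_count_def)
  ultimately show ?thesis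
    using sum_draws_le[of "{}" t] unfolding draws_avoiding_def by simp
qed

text \<open>For a fixed cap \<open>M\<close>, the runs still active after many rounds contribute at
  most \<open>M\<close> times a probability of order \<open>1 / t\<close>, which vanishes in the
  limit.\<close>

lemma capped_draws_sink_popping:
  "(\<integral>\<^sup>+ r. capped_draws M r \<partial>measure_pmf (sink_popping V E)) \<le> ennreal (card E + mean_draws)"
proof (rule LIMSEQ_le_const)
  have "(\<lambda>t. card E + mean_draws + M * mean_draws * (1 / real (Suc t)))
      \<longlonglongrightarrow> card E + mean_draws + M * mean_draws * 0"
    by (intro tendsto_intros LIMSEQ_Suc lim_1_over_n)
  then show "(\<lambda>t. ennreal (card E + mean_draws + M * mean_draws * (1 / real (Suc t))))
      \<longlonglongrightarrow> ennreal (card E + mean_draws)"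
    by (intro tendsto_ennrealI) simp
  have "(\<integral>\<^sup>+ r. capped_draws M r \<partial>measure_pmf (sink_popping V E))
      \<le> ennreal (card E + mean_draws + M * mean_draws * (1 / real (Suc t)))" for t
  proof -
    let ?O = "orientations E" and ?g = "\<lambda>\<sigma>. card E + draws (Suc t) \<sigma> + M * running (Suc t) \<sigma>"
    have "(\<integral>\<^sup>+ r. capped_draws M r \<partial>measure_pmf (sink_popping V E))
        = (\<integral>\<^sup>+ \<sigma>. \<integral>\<^sup>+ r. capped_draws M r \<partial>measure_pmf (pop_sinks V E \<sigma> (card E))
            \<partial>measure_pmf (random_orientation E))"
      by (simp add: sink_popping_def bind_spmf_of_pmf)
    also have "\<dots> \<le> (\<integral>\<^sup>+ \<sigma>. ennreal (?g \<sigma>) \<partial>measure_pmf (random_orientation E))"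
      by (rule nn_integral_mono) (rule capped_draws_pop_sinks)
    also have "\<dots> = ennreal ((\<Sum>\<sigma>\<in>?O. ?g \<sigma>) / 2 ^ card E)"
      by (rule nn_integral_random_orientation[OF order_refl])
         (intro add_nonneg_nonneg mult_nonneg_nonneg draws_nonneg running_bounds of_nat_0_le_iff)
    also have "\<dots> \<le> ennreal (card E + mean_draws + M * mean_draws * (1 / real (Suc t)))"
    proof (rule ennreal_leI)
      \<comment> \<open>Using \<open>Suc t\<close> rounds keeps the divisor positive. The survival
        term can then be absorbed into a slightly larger multiple of the draws.\<close>
      have run: "running (Suc t) \<sigma> \<le> draws (Suc t) \<sigma> / Suc t" for \<sigma>
        using running_le_draws[of "Suc t" \<sigma>] by (simp only: pos_le_divide_eq of_nat_0_less_iff zero_less_Suc mult.commute)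
      have "(\<Sum>\<sigma>\<in>?O. ?g \<sigma>) \<le> (\<Sum>\<sigma>\<in>?O. card E + (1 + M / Suc t) * draws (Suc t) \<sigma>)"
      proof (rule sum_mono)
        fix \<sigma>
        have "M * running (Suc t) \<sigma> \<le> M * (draws (Suc t) \<sigma> / Suc t)"
          by (intro mult_left_mono run) simp
        then show "?g \<sigma> \<le> card E + (1 + M / Suc t) * draws (Suc t) \<sigma>"
          by (simp only: distrib_right mult_1 times_divide_eq_left times_divide_eq_right)
      qed
      also have "\<dots> = card E * 2 ^ card E + (1 + M / Suc t) * (\<Sum>\<sigma>\<in>?O. draws (Suc t) \<sigma>)"
        by (simp add: sum.distrib card_orientations flip: sum_distrib_left)
      also have "\<dots> \<le> card E * 2 ^ card E + (1 + M / Suc t) * (mean_draws * 2 ^ card E)"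
        by (intro add_left_mono mult_left_mono sum_draws_le_mean) simp
      also have "\<dots> = (card E + mean_draws + M * mean_draws * (1 / real (Suc t))) * 2 ^ card E"
        by (simp add: algebra_simps)
      finally show "(\<Sum>\<sigma>\<in>?O. ?g \<sigma>) / 2 ^ card E
          \<le> card E + mean_draws + M * mean_draws * (1 / real (Suc t))"
        by (subst pos_divide_le_eq) simp_all
    qed
    finally show ?thesis .
  qed
  then show "\<exists>N. \<forall>t\<ge>N. (\<integral>\<^sup>+ r. capped_draws M r \<partial>measure_pmf (sink_popping V E))
      \<le> ennreal (card E + mean_draws + M * mean_draws * (1 / real (Suc t)))"
    by blast
qed

text \<open>Monotone convergence in the cap. The bound is independent of \<open>M\<close>, which
  also forces the non-terminating runs to have probability zero.\<close>

lemma expected_draws_le: "expected_draws V E \<le> ennreal (card E + mean_draws)"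
proof -
  have "(case r of None \<Rightarrow> \<infinity> | Some (\<sigma>, k) \<Rightarrow> of_nat k) \<le> (SUP M. capped_draws M r)" for r
  proof (cases r)
    case None
    \<comment> \<open>A non-terminating run has capped cost \<open>M\<close>, whose supremum is
      infinite, matching the convention in \<open>expected_draws\<close>.\<close>
    then show ?thesis by (simp add: capped_draws_def ennreal_SUP_of_nat_eq_top)
  next
    case (Some p)
    then show ?thesis
      by (cases p) (auto simp: capped_draws_def intro!: SUP_upper2[of "snd p"])
  qed
  then have "expected_draws V E \<le> (\<integral>\<^sup>+ r. (SUP M. capped_draws M r) \<partial>measure_pmf (sink_popping V E))"
    unfolding expected_draws_def by (intro nn_integral_mono)
  also have "\<dots> = (SUP M. \<integral>\<^sup>+ r. capped_draws M r \<partial>measure_pmf (sink_popping V E))"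
  proof (rule nn_integral_monotone_convergence_SUP)
    show "incseq capped_draws"
      by (intro incseq_SucI le_funI) (auto simp: capped_draws_def min_def split: option.splits)
  qed simp
  also have "\<dots> \<le> ennreal (card E + mean_draws)"
    by (rule SUP_least) (rule capped_draws_sink_popping)
  finally show ?thesis .
qed

lemma mean_draws_le: "mean_draws \<le> card V * (card V - 1)"
proof -
  have "(\<Sum>v\<in>V. card (incident E {v}) * sink_count V E (\<lambda>X. X = {v}))
      \<le> card V * (card V - 1) * sink_count V E (\<lambda>X. X = {})"
    using sink_count_singleton_bounds[OF simple sink_free] by blast
  then have "real (\<Sum>v\<in>V. card (incident E {v}) * sink_count V E (\<lambda>X. X = {v}))
      \<le> real (card V * (card V - 1) * sink_count V E (\<lambda>X. X = {}))"
    by (simp only: of_nat_le_iff)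
  then show ?thesis
    using sink_free unfolding mean_draws_def by (simp add: pos_divide_le_eq)
qed

end

theorem theorem5p4:
  fixes V :: "'a set" and E :: "'a set set" and n m :: nat
  assumes "simple_graph V E"
    and "connected_graph V E"
    and "\<not> is_tree V E"
    and "n = card V"
    and "m = card E"
  shows "expected_draws V E \<le> of_nat (m + n * (n - 1))"
proof -
  interpret graph V E by standard (rule assms(1))
  interpret sink_free_graph V E
    by standard (rule sink_free_orientation_exists[OF assms(2,3)])
  have "expected_draws V E \<le> ennreal (card E + mean_draws)" by (rule expected_draws_le)
  also have "\<dots> \<le> ennreal (real (m + n * (n - 1)))"
    using mean_draws_le by (intro ennreal_leI) (simp add: assms(4,5))
  finally show ?thesis by (simp only: ennreal_of_nat_eq_real_of_nat)
qed

end
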